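(* Let $0<\beta\le1$. (i) The integrals $\int_a^b f(t,g(t))\,dg(t)$ and, consequently, $\int_a^b f(t)\,dg(t)$ ($0\le a<b\le1$) exist for $W$-almost every $g\in C([0,1])$ and for every function $f$ from $H_\beta$ if and only if $\beta>1/2$. (ii) For $W$-almost every $g\in C([0,1])$ there exists a function $f$ from $H_\beta$ such that the integral $\int_a^b f(t,g(t))\,dg(t)$ does not exist (for some $0\le a<b\le1$) if and only if $\beta\le1/2$. Here the exceptional null set of $g$ does not depend on $f$.
   Context: $W$ is the Wiener measure on $C([0,1])$ (the law of standard Brownian motion started at $0$). For $0<\beta\le1$, $H_\beta([0,1])$ is the class of functions with finite seminorm $|f,H_\beta([0,1])|=\sup_{s\ne t\in[0,1]}|f(s)-f(t)|/|s-t|^\beta$. For the integral $\int_a^b f(t,g(t))\,dg(t)$, "$f$ from $H_\beta$" means: $f:[0,1]\times\mathbb{R}\to\mathbb{R}$ is continuous and $\sup_{x\in[c,d]}|f(\cdot,x),H_\beta([0,1])|<\infty$ for every compact interval $[c,d]$; for $\int_a^b f(t)\,dg(t)$ it means $f\in H_\beta([0,1])$. For $g\in C([0,1])$ put $t_{k,n}=n2^{-k}$ and $h_{k,n}=h_{k,n}(g)=2^k\int_{t_{k,n}}^{t_{k,n+1}}g(\tau)\,d\tau$ for $k\ge0$, $0\le n<2^k$. For $0\le a<b\le1$ and $k\ge1$ let $n_k(a)$ and $n_k(b)$ be the smallest and the largest element of the set of consecutive integers $\{n:\ 0\le n\le 2^k,\ [t_{k-1,\lfloor n/2\rfloor},t_{k-1,\lfloor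 n/2\rfloor+1}]\subset[a,b]\}$ (if this set is empty, the sum below is $0$). By definition, $$\int_a^b f(t,g(t))\,dg(t)=\lim_{k\to\infty}\sum_{n=n_k(a)+1}^{n_k(b)}\int_{h_{k,n-1}}^{h_{k,n}}f(t_{k,n},x)\,dx,$$ and the integral exists if this limit exists (finite). $\int_a^bf(t)\,dg(t)$ is the special case in which $f(t,x)=f(t)$. *)

theory Defs
  imports "HOL-Probability.Probability"
begin

text \<open>
  Functions on \<open>[0,1]\<close> are represented by total functions on the reals of which
  only the values on \<open>{0..1}\<close> are used; as points of the path space they are taken to be
  extensional, so that every path is represented exactly once.
\<close>

definition C01 :: "(real \<Rightarrow> real) set" where
  "C01 = {g \<in> extensional {0..1}. continuous_on {0..1} g}"

text \<open>
  The trace of the product sigma-algebra on \<open>C01\<close> (generated by the evaluations) is the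
  Borel sigma-algebra of the uniform norm.  The law of standard Brownian motion started at 0 is
  the only measure satisfying the following conditions.
\<close>

definition wiener_measure :: "(real \<Rightarrow> real) measure \<Rightarrow> bool" where
  "wiener_measure W \<longleftrightarrow>
     prob_space W \<and>
     space W = C01 \<and>
     sets W = sets (restrict_space (\<Pi>\<^sub>M t\<in>{0..1}. borel) C01) \<and>
     (AE g in W. g 0 = 0) \<and>
     (\<forall>s t. 0 \<le> s \<and> s < t \<and> t \<le> 1 \<longrightarrow>
        distributed W lborel (\<lambda>g. g t - g s) (normal_density 0 (sqrt (t - s)))) \<and>
     (\<forall>(m::nat) (u::nat \<Rightarrow> real).
        0 \<le> u 0 \<and> (\<forall>i<m. u i < u (Suc i)) \<and> u m \<le> 1 \<longrightarrow>
        prob_space.indep_vars W (\<lambda>_. borel) (\<lambda>i g. g (u (Suc i)) - g (u i)) {..<m})"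

definition holder_seminorm :: "real \<Rightarrow> (real \<Rightarrow> real) \<Rightarrow> ereal" where
  "holder_seminorm \<beta> f =
     (SUP (s, t) \<in> {(s, t). s \<in> {0..1} \<and> t \<in> {0..1} \<and> s \<noteq> t}.
        ereal (\<bar>f s - f t\<bar> / \<bar>s - t\<bar> powr \<beta>))"

definition holder :: "real \<Rightarrow> (real \<Rightarrow> real) set" where
  "holder \<beta> = {f. holder_seminorm \<beta> f < \<infinity>}"

definition holder2 :: "real \<Rightarrow> (real \<Rightarrow> real \<Rightarrow> real) set" where
  "holder2 \<beta> =
     {f. continuous_on ({0..1} \<times> UNIV) (\<lambda>(t, x). f t x) \<and>
         (\<forall>c d. c \<le> d \<longrightarrow> (SUP x\<in>{c..d}. holder_seminorm \<beta> (\<lambda>t. f t x)) < \<infinity>)}"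

definition dyadic :: "nat \<Rightarrow> nat \<Rightarrow> real" where
  "dyadic k n = real n / 2 ^ k"

definition dyadic_mean :: "(real \<Rightarrow> real) \<Rightarrow> nat \<Rightarrow> nat \<Rightarrow> real" where
  "dyadic_mean g k n =
     2 ^ k * (LBINT \<tau>=ereal (dyadic k n)..ereal (dyadic k (n + 1)). g \<tau>)"

text \<open>Only levels \<open>k \<ge> 1\<close> are meaningful below; level 0 has no influence on the limit.\<close>

definition index_set :: "real \<Rightarrow> real \<Rightarrow> nat \<Rightarrow> nat set" where
  "index_set a b k =
     {n. n \<le> 2 ^ k \<and> {dyadic (k - 1) (n div 2)..dyadic (k - 1) (n div 2 + 1)} \<subseteq> {a..b}}"

text \<open>
  The inner integral is oriented: it changes sign when its limits are exchanged.
\<close>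

definition dyadic_sum ::
    "(real \<Rightarrow> real \<Rightarrow> real) \<Rightarrow> (real \<Rightarrow> real) \<Rightarrow> real \<Rightarrow> real \<Rightarrow> nat \<Rightarrow> real" where
  "dyadic_sum f g a b k =
     (if index_set a b k = {} then 0
      else \<Sum>n = Min (index_set a b k) + 1..Max (index_set a b k).
             LBINT x=ereal (dyadic_mean g k (n - 1))..ereal (dyadic_mean g k n).
               f (dyadic k n) x)"

definition has_dg_integral ::
    "(real \<Rightarrow> real \<Rightarrow> real) \<Rightarrow> (real \<Rightarrow> real) \<Rightarrow> real \<Rightarrow> real \<Rightarrow> real \<Rightarrow> bool" where
  "has_dg_integral f g a b I \<longleftrightarrow> dyadic_sum f g a b \<longlonglongrightarrow> I"

definition dg_integrable ::
    "(real \<Rightarrow> real \<Rightarrow> real) \<Rightarrow> (real \<Rightarrow> real) \<Rightarrow> real \<Rightarrow> real \<Rightarrow> bool" where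
  "dg_integrable f g a b \<longleftrightarrow> (\<exists>I. has_dg_integral f g a b I)"

end

theory Submission
  imports Defs
begin

text \<open>
  Halving the mesh changes the approximating sum in a controlled way.  Write \<open>h\<close> for the mean
  of \<open>g\<close> over a cell of level \<open>k\<close> and \<open>e\<close>, \<open>r\<close> for the means over its two halves, so that \<open>h\<close> is the
  midpoint of \<open>e\<close> and \<open>r\<close>.  The finer staircase runs through the same values as the coarser one, only
  the times at which the integrand is sampled move by \<open>2 powr (- k - 1)\<close> on the pieces between \<open>e\<close>,
  \<open>h\<close> and \<open>r\<close> (\<open>dyadic_term_refinement\<close>).  Hence the sums of two consecutive levels
  differ, up to contributions of the two ends of the interval, by at most a constant times
  \<open>2 powr (- \<beta> k) * L k\<close>, where \<open>L k\<close> is the sum of the absolute differences of neighbouring means.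

  For Brownian motion \<open>L k\<close> consists of about \<open>2 ^ k\<close> differences of size \<open>2 powr (- k / 2)\<close>, so it is of
  order \<open>2 powr (k / 2)\<close>, and the steps are summable if \<open>\<beta> > 1 / 2\<close>.  The exceptional set must not
  depend on the integrand, and it does not: the only thing required of the path is a bound on the sums of
  the fourth powers of the differences (\<open>AE_quartic_variation_bound\<close>), from which
  \<open>dg_integrable_if_quartic_variation_bound\<close> deduces convergence for all integrands at once.

  If \<open>\<beta> \<le> 1 / 2\<close>, a bad integrand is adapted to the given path.  For an integrand that depends on the
  time alone and vanishes at 0 and 1, the step between two levels on \<open>[0, 1]\<close> is exactly the sum over
  all cells of the second difference of \<open>f\<close> times half of \<open>r - e\<close>.  A Faber-Schauder series whose
  coefficients at level \<open>k\<close> are \<open>2 powr (- k / 2)\<close> times arbitrary signs is Hoelder continuous with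
  exponent 1/2, and its second differences are twice these coefficients.  Choosing the signs of \<open>r - e\<close>
  makes the step equal to \<open>2 powr (- k / 2)\<close> times the sum of the \<open>\<bar>r - e\<bar>\<close>
  (\<open>not_dg_integrable_if_oscillation\<close>).  For Brownian motion the differences \<open>r - e\<close> of
  different cells are independent Gaussian variables with variance of order \<open>2 powr (- k)\<close>, so this quantity
  does not tend to 0 almost surely (\<open>AE_oscillation_not_null\<close>).
\<close>

section \<open>Hoelder classes\<close>

lemma holder_seminorm_le:
  assumes "\<And>s t. s \<in> {0..1} \<Longrightarrow> t \<in> {0..1} \<Longrightarrow> \<bar>f s - f t\<bar> \<le> C * \<bar>s - t\<bar> powr \<beta>"
  shows "holder_seminorm \<beta> f \<le> ereal C"
  unfolding holder_seminorm_def
  by (rule SUP_least) (use assms in \<open>auto simp: divide_le_eq\<close>)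

lemma holder_seminorm_bound:
  assumes "holder_seminorm \<beta> f \<le> ereal C" "s \<in> {0..1}" "t \<in> {0..1}"
  shows "\<bar>f s - f t\<bar> \<le> C * \<bar>s - t\<bar> powr \<beta>"
proof (cases "s = t")
  case False
  have "ereal (\<bar>f s - f t\<bar> / \<bar>s - t\<bar> powr \<beta>) \<le> holder_seminorm \<beta> f"
    unfolding holder_seminorm_def
    by (rule SUP_upper2[of "(s, t)"]) (use False assms in auto)
  with assms(1) have "ereal (\<bar>f s - f t\<bar> / \<bar>s - t\<bar> powr \<beta>) \<le> ereal C"
    by (rule order_trans[rotated])
  with False show ?thesis by (simp add: divide_le_eq)
qed simp

lemma ereal_less_PInf_imp_le_real:
  fixes x :: ereal
  assumes "x < \<infinity>"
  obtains C :: real where "0 \<le> C" "x \<le> ereal C"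
proof (cases x)
  case (real r)
  then show ?thesis using that[of "max 0 r"] by simp
qed (use assms that[of 0] in auto)

lemma holder_bound:
  assumes "f \<in> holder \<beta>"
  obtains C where "0 \<le> C"
    "\<And>s t. s \<in> {0..1} \<Longrightarrow> t \<in> {0..1} \<Longrightarrow> \<bar>f s - f t\<bar> \<le> C * \<bar>s - t\<bar> powr \<beta>"
  using assms ereal_less_PInf_imp_le_real holder_seminorm_bound
  unfolding holder_def by (metis mem_Collect_eq)

lemma holder2_local_bound:
  assumes "f \<in> holder2 \<beta>" "c \<le> d"
  obtains C where "0 \<le> C"
    "\<And>s t x. s \<in> {0..1} \<Longrightarrow> t \<in> {0..1} \<Longrightarrow> x \<in> {c..d} \<Longrightarrow>
       \<bar>f s x - f t x\<bar> \<le> C * \<bar>s - t\<bar> powr \<beta>"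
proof -
  have "(SUP x\<in>{c..d}. holder_seminorm \<beta> (\<lambda>t. f t x)) < \<infinity>"
    using assms by (auto simp: holder2_def)
  then obtain C where C: "0 \<le> C" "(SUP x\<in>{c..d}. holder_seminorm \<beta> (\<lambda>t. f t x)) \<le> ereal C"
    by (rule ereal_less_PInf_imp_le_real)
  have "holder_seminorm \<beta> (\<lambda>t. f t x) \<le> ereal C" if "x \<in> {c..d}" for x
    using C(2) that by (simp add: SUP_le_iff)
  with C(1) holder_seminorm_bound show ?thesis by (intro that[of C]) blast+
qed

lemma holder_antimono:
  assumes "\<And>s t. s \<in> {0..1} \<Longrightarrow> t \<in> {0..1} \<Longrightarrow> \<bar>f s - f t\<bar> \<le> C * \<bar>s - t\<bar> powr \<gamma>"
    and "0 \<le> C" "0 < \<beta>" "\<beta> \<le> \<gamma>"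
  shows "f \<in> holder \<beta>"
proof -
  have "\<bar>f s - f t\<bar> \<le> C * \<bar>s - t\<bar> powr \<beta>" if "s \<in> {0..1}" "t \<in> {0..1}" for s t
  proof -
    have "\<bar>s - t\<bar> powr \<gamma> \<le> \<bar>s - t\<bar> powr \<beta>"
      using that assms(3,4) by (intro powr_mono') auto
    with assms(1)[OF that] assms(2) show ?thesis
      by (meson mult_left_mono order_trans)
  qed
  then have "holder_seminorm \<beta> f \<le> ereal C" by (rule holder_seminorm_le)
  then show ?thesis by (auto simp: holder_def intro: le_less_trans)
qed

lemma holder_continuous_on:
  assumes "f \<in> holder \<beta>" "0 < \<beta>"
  shows "continuous_on {0..1} f"
  unfolding continuous_on_def
proof
  fix x :: real assume x: "x \<in> {0..1}"
  obtain C where C: "0 \<le> C"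
    "\<And>s t. s \<in> {0..1} \<Longrightarrow> t \<in> {0..1} \<Longrightarrow> \<bar>f s - f t\<bar> \<le> C * \<bar>s - t\<bar> powr \<beta>"
    using assms(1) by (rule holder_bound) blast
  have "((\<lambda>s. C * \<bar>s - x\<bar> powr \<beta>) \<longlongrightarrow> C * \<bar>x - x\<bar> powr \<beta>) (at x within {0..1})"
    using assms(2) by (intro tendsto_intros tendsto_powr') auto
  then have lim: "((\<lambda>s. C * \<bar>s - x\<bar> powr \<beta>) \<longlongrightarrow> 0) (at x within {0..1})"
    by simp
  have "((\<lambda>s. f s - f x) \<longlongrightarrow> 0) (at x within {0..1})"
    by (rule Lim_null_comparison[OF _ lim])
      (use C(2) x in \<open>auto simp: eventually_at_filter\<close>)
  then show "(f \<longlongrightarrow> f x) (at x within {0..1})" by (rule LIM_zero_cancel)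
qed

lemma holder_imp_holder2:
  assumes "f \<in> holder \<beta>" "0 < \<beta>"
  shows "(\<lambda>t x. f t) \<in> holder2 \<beta>"
proof -
  have "continuous_on ({0..1} \<times> UNIV) (\<lambda>p::real \<times> real. f (fst p))"
    by (rule continuous_on_compose2[OF holder_continuous_on[OF assms]])
       (auto intro!: continuous_intros)
  then show ?thesis using assms by (auto simp: holder2_def holder_def case_prod_unfold)
qed

section \<open>Dyadic means\<close>

lemma dyadic_mono: "m \<le> n \<Longrightarrow> dyadic k m \<le> dyadic k n"
  by (simp add: dyadic_def divide_right_mono)

lemma dyadic_unit: "n \<le> 2 ^ k \<Longrightarrow> dyadic k n \<in> {0..1}"
proof -
  assume "n \<le> 2 ^ k"
  then have "real n \<le> real (2 ^ k)" by (rule of_nat_mono)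
  then show ?thesis by (simp add: dyadic_def)
qed

lemma dyadic_double: "dyadic (Suc k) (2 * n) = dyadic k n"
  by (simp add: dyadic_def)

lemma dyadic_Suc: "dyadic k (Suc n) = dyadic k n + 1 / 2 ^ k"
  by (simp add: dyadic_def add_divide_distrib)

lemma dyadic_interval_subset: "n < 2 ^ k \<Longrightarrow> {dyadic k n..dyadic k (n + 1)} \<subseteq> {0..1}"
  using dyadic_unit[of n k] dyadic_unit[of "n + 1" k] by auto

lemma dyadic_mean_eq_integral:
  assumes "continuous_on {0..1} g" "n < 2 ^ k"
  shows "dyadic_mean g k n = 2 ^ k * integral {dyadic k n..dyadic k (n + 1)} g"
proof -
  have "continuous_on {dyadic k n..dyadic k (n + 1)} g"
    using assms dyadic_interval_subset continuous_on_subset by blast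
  then show ?thesis
    unfolding dyadic_mean_def
    by (subst interval_integral_eq_integral)
       (auto intro: dyadic_mono borel_integrable_atLeastAtMost')
qed

lemma riemann_sum_tendsto_integral:
  fixes g :: "real \<Rightarrow> real"
  assumes cont: "continuous_on {a..b} g" and ab: "a < b"
  shows "(\<lambda>N. (b - a) / real N * (\<Sum>j<N. g (a + real j * ((b - a) / real N))))
           \<longlonglongrightarrow> integral {a..b} g"
proof (rule LIMSEQ_I)
  fix r :: real assume r: "0 < r"
  define e where "e = r / (2 * (b - a))"
  have e: "0 < e" using r ab by (simp add: e_def)
  have "uniformly_continuous_on {a..b} g"
    using cont compact_uniformly_continuous by blast
  then obtain d where d: "0 < d"
    "\<And>x y. x \<in> {a..b} \<Longrightarrow> y \<in> {a..b} \<Longrightarrow> \<bar>y - x\<bar> < d \<Longrightarrow> \<bar>g y - g x\<bar> < e"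
    using e unfolding uniformly_continuous_on_def dist_real_def by metis
  obtain N0 :: nat where N0: "(b - a) / d < real N0"
    using reals_Archimedean2 by blast
  show "\<exists>N0. \<forall>N\<ge>N0. norm ((b - a) / real N * (\<Sum>j<N. g (a + real j * ((b - a) / real N)))
            - integral {a..b} g) < r"
  proof (intro exI[of _ "max 1 N0"] allI impI)
    fix N assume N: "max 1 N0 \<le> N"
    define h where "h = (b - a) / real N"
    define x where "x j = a + real j * h" for j
    have Npos: "0 < N" using N by simp
    have h0: "0 < h" using ab Npos by (simp add: h_def)
    have "(b - a) / d < real N" using N N0 by linarith
    then have hd: "h < d" using d(1) Npos by (simp add: h_def field_simps)
    have xN: "x N = b" "x 0 = a" using Npos by (simp_all add: x_def h_def)
    have xmono: "x i \<le> x j" if "i \<le> j" for i j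
      using that h0 by (simp add: x_def)
    have step: "\<bar>h * g (x j) - integral {x j..x (Suc j)} g\<bar> \<le> e * h" if j: "j < N" for j
    proof -
      have sub: "{x j..x (Suc j)} \<subseteq> {a..b}"
        using xmono[of 0 j] xmono[of "Suc j" N] j xN by auto
      have xs: "x (Suc j) - x j = h" by (simp add: x_def algebra_simps)
      have int: "g integrable_on {x j..x (Suc j)}"
        using cont sub continuous_on_subset integrable_continuous_interval by blast
      have "integral {x j..x (Suc j)} (\<lambda>y. g (x j) - g y)
          = integral {x j..x (Suc j)} (\<lambda>y. g (x j)) - integral {x j..x (Suc j)} g"
        by (rule Henstock_Kurzweil_Integration.integral_diff[OF _ int]) auto
      also have "\<dots> = h * g (x j) - integral {x j..x (Suc j)} g"
        using xs h0 by simp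
      finally have eq: "integral {x j..x (Suc j)} (\<lambda>y. g (x j) - g y)
          = h * g (x j) - integral {x j..x (Suc j)} g" .
      have "norm (integral {x j..x (Suc j)} (\<lambda>y. g (x j) - g y)) \<le> e * (x (Suc j) - x j)"
      proof (rule integral_bound)
        show "continuous_on {x j..x (Suc j)} (\<lambda>y. g (x j) - g y)"
          by (intro continuous_intros continuous_on_subset[OF cont sub])
        show "norm (g (x j) - g y) \<le> e" if "y \<in> {x j..x (Suc j)}" for y
          using d(2)[of y "x j"] sub that xs hd xmono[of j "Suc j"]
          by (force simp: less_imp_le)
      qed (use xmono in auto)
      with eq xs show ?thesis by simp
    qed
    have tel: "(\<Sum>j<n. integral {x j..x (Suc j)} g) = integral {a..x n} g" if "n \<le> N" for n
      using that
    proof (induction n)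
      case (Suc n)
      have "integral {x 0..x n} g + integral {x n..x (Suc n)} g = integral {x 0..x (Suc n)} g"
      proof (rule Henstock_Kurzweil_Integration.integral_combine)
        have "{x 0..x (Suc n)} \<subseteq> {a..b}" using xmono[of "Suc n" N] Suc.prems xN by auto
        then show "g integrable_on {x 0..x (Suc n)}"
          using cont continuous_on_subset integrable_continuous_interval by blast
      qed (use xmono in auto)
      with Suc xN show ?case by simp
    qed (simp add: xN)
    have "h * (\<Sum>j<N. g (x j)) - integral {a..b} g
        = (\<Sum>j<N. h * g (x j) - integral {x j..x (Suc j)} g)"
      using tel[of N] xN by (simp add: sum_subtractf sum_distrib_left)
    also have "\<bar>\<dots>\<bar> \<le> (\<Sum>j<N. e * h)"
      by (rule order_trans[OF sum_abs sum_mono]) (use step in auto)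
    also have "\<dots> = e * (b - a)" using Npos by (simp add: h_def)
    also have "\<dots> = r / 2" using ab by (simp add: e_def field_simps)
    finally show "norm ((b - a) / real N * (\<Sum>j<N. g (a + real j * ((b - a) / real N)))
            - integral {a..b} g) < r"
      using r by (simp add: h_def x_def)
  qed
qed

text \<open>
  Dyadic means are not evaluations of the path, so their joint law is not given directly.
  Averages over finite grids approximate them pathwise, and all moment and independence
  statements below are transported along this limit.
\<close>
lemma dyadic_mean_grid_limit:
  assumes "continuous_on {0..1} g" "n < 2 ^ k"
  shows "(\<lambda>N. (\<Sum>j<N. g (dyadic k n + real j / (2 ^ k * real N))) / real N)
           \<longlonglongrightarrow> dyadic_mean g k n"
proof -
  have cont: "continuous_on {dyadic k n..dyadic k (n + 1)} g"
    using assms dyadic_interval_subset continuous_on_subset by blast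
  have len: "dyadic k (n + 1) - dyadic k n = 1 / 2 ^ k"
    by (simp add: dyadic_Suc)
  have "(\<lambda>N. 2 ^ k * ((dyadic k (n + 1) - dyadic k n) / real N *
          (\<Sum>j<N. g (dyadic k n + real j * ((dyadic k (n + 1) - dyadic k n) / real N)))))
        \<longlonglongrightarrow> 2 ^ k * integral {dyadic k n..dyadic k (n + 1)} g"
    by (intro tendsto_mult_left riemann_sum_tendsto_integral cont) (simp add: dyadic_Suc)
  then show ?thesis
    unfolding len dyadic_mean_eq_integral[OF assms] by simp
qed

lemma dyadic_mean_halves:
  assumes "continuous_on {0..1} g" "n < 2 ^ k"
  shows "dyadic_mean g k n =
    (dyadic_mean g (Suc k) (2 * n) + dyadic_mean g (Suc k) (2 * n + 1)) / 2"
proof -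
  have n: "2 * n < 2 ^ Suc k" "2 * n + 1 < 2 ^ Suc k" using assms(2) by auto
  have e: "dyadic (Suc k) (2 * n) = dyadic k n" "dyadic (Suc k) (2 * n + 1 + 1) = dyadic k (n + 1)"
    using dyadic_double[of k n] dyadic_double[of k "n + 1"] by simp_all
  have "continuous_on {dyadic k n..dyadic k (n + 1)} g"
    using assms dyadic_interval_subset continuous_on_subset by blast
  then have "g integrable_on {dyadic k n..dyadic k (n + 1)}"
    by (rule integrable_continuous_interval)
  then have comb: "integral {dyadic k n..dyadic (Suc k) (2 * n + 1)} g
      + integral {dyadic (Suc k) (2 * n + 1)..dyadic k (n + 1)} g
      = integral {dyadic k n..dyadic k (n + 1)} g" (is "?A + ?B = ?C")
    using dyadic_mono[of "2 * n" "2 * n + 1" "Suc k"] dyadic_mono[of "2 * n + 1" "2 * n + 1 + 1" "Suc k"]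
    by (intro Henstock_Kurzweil_Integration.integral_combine) (simp_all only: e le_add1)
  have "2 ^ k * ?C = 2 ^ k * (?A + ?B)" by (simp only: comb)
  also have "\<dots> = (2 ^ Suc k * ?A + 2 ^ Suc k * ?B) / 2" by (simp only: power_Suc ring_distribs) simp
  finally show ?thesis
    unfolding dyadic_mean_eq_integral[OF assms] dyadic_mean_eq_integral[OF assms(1) n(1)]
      dyadic_mean_eq_integral[OF assms(1) n(2)] e .
qed

lemma dyadic_mean_bound:
  assumes "continuous_on {0..1} g" "n < 2 ^ k" "\<And>t. t \<in> {0..1} \<Longrightarrow> \<bar>g t\<bar> \<le> M"
  shows "dyadic_mean g k n \<in> {-M..M}"
proof -
  have "norm (integral {dyadic k n..dyadic k (n + 1)} g) \<le> M * (dyadic k (n + 1) - dyadic k n)"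
    using assms dyadic_interval_subset[OF assms(2)] 
    by (intro integral_bound continuous_on_subset[OF assms(1)] dyadic_mono) auto
  then have "\<bar>integral {dyadic k n..dyadic k (n + 1)} g\<bar> \<le> M / 2 ^ k"
    by (simp add: dyadic_Suc)
  then have "2 ^ k * \<bar>integral {dyadic k n..dyadic k (n + 1)} g\<bar> \<le> M"
    by (simp add: field_simps)
  then have "\<bar>dyadic_mean g k n\<bar> \<le> M"
    unfolding dyadic_mean_eq_integral[OF assms(1,2)] by (simp add: abs_mult)
  then show ?thesis by auto
qed

section \<open>Passing from one dyadic level to the next\<close>

lemma sum_odd_even_split:
  fixes t :: "nat \<Rightarrow> real"
  assumes "A < B"
  shows "(\<Sum>m=Suc (2 * A)..<2 * B. t m) =
    (\<Sum>n=A..<B. t (2 * n + 1)) + (\<Sum>n=Suc A..<B. t (2 * n))"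
  using assms
proof (induction B)
  case (Suc B)
  show ?case
  proof (cases "A < B")
    case True
    have "(\<Sum>m=Suc (2 * A)..<2 * Suc B. t m) = (\<Sum>m=Suc (2 * A)..<2 * B. t m) + t (2 * B) + t (2 * B + 1)"
      using True by (simp add: sum.atLeastLessThan_Suc)
    with Suc.IH[OF True] True show ?thesis by (simp add: sum.atLeastLessThan_Suc)
  next
    case False
    with Suc.prems have "A = B" by simp
    then show ?thesis by simp
  qed
qed simp

text \<open>
  Halving the mesh replaces each value \<open>h n\<close> of the coarse staircase by two values
  \<open>e n\<close> and \<open>r n\<close> and adds a sampling time in the middle.  Every piece of the
  coarse path is traversed by the fine path too, only with the integrand taken at a
  neighbouring time; what remains is a sum of differences of the integrand between neighbouring
  times, over the short ranges between \<open>e n\<close>, \<open>h n\<close> and \<open>r n\<close>.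
  Here \<open>p n\<close> and \<open>q n\<close> are primitives of the integrand at the left end point and at
  the midpoint of the \<open>n\<close>-th coarse interval.
\<close>
lemma refinement_identity:
  fixes p q :: "nat \<Rightarrow> real \<Rightarrow> real" and e h r :: "nat \<Rightarrow> real"
  assumes "A < B"
  shows "(\<Sum>n=A..<B. q n (r n) - q n (e n)) + (\<Sum>n=Suc A..<B. p n (e n) - p n (r (n - 1)))
      - (\<Sum>n=Suc A..<B. p n (h n) - p n (h (n - 1)))
    = (\<Sum>n=A..<B. ((q n (h n) - q n (e n)) - (p n (h n) - p n (e n)))
         + ((q n (r n) - q n (h n)) - (p (Suc n) (r n) - p (Suc n) (h n))))
      + (p A (h A) - p A (e A)) + (p B (r (B - 1)) - p B (h (B - 1)))"
  using assms
proof (induction B)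
  case (Suc B)
  show ?case
  proof (cases "A < B")
    case True
    from Suc.IH[OF True] True show ?thesis by (simp add: sum.atLeastLessThan_Suc)
  next
    case False
    with Suc.prems have "A = B" by simp
    then show ?thesis by simp
  qed
qed simp

definition mean_inc :: "(real \<Rightarrow> real) \<Rightarrow> nat \<Rightarrow> nat \<Rightarrow> real" where
  "mean_inc g k m = dyadic_mean g k m - dyadic_mean g k (m - 1)"

definition primitive :: "(real \<Rightarrow> real \<Rightarrow> real) \<Rightarrow> real \<Rightarrow> real \<Rightarrow> real" where
  "primitive f t v = (LBINT x=ereal 0..ereal v. f t x)"

definition dyadic_term :: "(real \<Rightarrow> real \<Rightarrow> real) \<Rightarrow> (real \<Rightarrow> real) \<Rightarrow> nat \<Rightarrow> nat \<Rightarrow> real" where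
  "dyadic_term f g k n =
     (LBINT x=ereal (dyadic_mean g k (n - 1))..ereal (dyadic_mean g k n). f (dyadic k n) x)"

lemma interval_integrable_continuous:
  fixes \<phi> :: "real \<Rightarrow> real" and u v :: real
  assumes "continuous_on UNIV \<phi>"
  shows "interval_lebesgue_integrable lborel (ereal u) (ereal v) \<phi>"
proof (cases "u \<le> v")
  case True
  then show ?thesis
    using assms by (intro interval_integrable_continuous_on continuous_on_subset[OF assms]) auto
next
  case False
  then show ?thesis
    by (subst interval_integrable_endpoints_reverse)
       (intro interval_integrable_continuous_on continuous_on_subset[OF assms], auto)
qed

lemma interval_integral_eq_primitive:
  assumes "continuous_on UNIV (f t)"
  shows "(LBINT x=ereal u..ereal v. f t x) = primitive f t v - primitive f t u"
proof -
  have "(LBINT x=ereal 0..ereal u. f t x) + (LBINT x=ereal u..ereal v. f t x)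
      = (LBINT x=ereal 0..ereal v. f t x)"
    by (rule interval_integral_sum, rule interval_integrable_continuous[OF assms,
          of "min 0 (min u v)" "max 0 (max u v)", unfolded ereal_min ereal_max])
  then show ?thesis by (simp add: primitive_def)
qed

lemma dyadic_term_eq_primitive:
  assumes "continuous_on UNIV (f (dyadic k n))"
  shows "dyadic_term f g k n = primitive f (dyadic k n) (dyadic_mean g k n)
    - primitive f (dyadic k n) (dyadic_mean g k (n - 1))"
  unfolding dyadic_term_def by (rule interval_integral_eq_primitive[of f "dyadic k n", OF assms])

lemma interval_integral_abs_le:
  fixes \<phi> :: "real \<Rightarrow> real"
  assumes cont: "continuous_on UNIV \<phi>" and bd: "\<And>x. x \<in> {c..d} \<Longrightarrow> \<bar>\<phi> x\<bar> \<le> B"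
    and "u \<in> {c..d}" "v \<in> {c..d}"
  shows "\<bar>LBINT x=ereal u..ereal v. \<phi> x\<bar> \<le> B * \<bar>v - u\<bar>"
proof -
  have ord: "\<bar>LBINT x=ereal u..ereal v. \<phi> x\<bar> \<le> B * (v - u)"
    if "u \<le> v" "u \<in> {c..d}" "v \<in> {c..d}" for u v
  proof -
    have c: "continuous_on {u..v} \<phi>" using cont continuous_on_subset by blast
    have "(LBINT x=ereal u..ereal v. \<phi> x) = integral {u..v} \<phi>"
      by (rule interval_integral_eq_integral[OF that(1) borel_integrable_atLeastAtMost'[OF c]])
    moreover have "norm (integral {u..v} \<phi>) \<le> B * (v - u)"
      by (rule integral_bound[OF that(1) c]) (use bd that in auto)
    ultimately show ?thesis by simp
  qed
  show ?thesis
  proof (cases "u \<le> v")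
    case True
    with ord[of u v] assms show ?thesis by simp
  next
    case False
    have "\<bar>LBINT x=ereal u..ereal v. \<phi> x\<bar> = \<bar>LBINT x=ereal v..ereal u. \<phi> x\<bar>"
      by (subst interval_integral_endpoints_reverse) simp
    with False ord[of v u] assms show ?thesis by simp
  qed
qed

lemma primitive_diff_le:
  assumes "continuous_on UNIV (f t)" "\<And>x. x \<in> {c..d} \<Longrightarrow> \<bar>f t x\<bar> \<le> B"
    and "u \<in> {c..d}" "v \<in> {c..d}"
  shows "\<bar>primitive f t v - primitive f t u\<bar> \<le> B * \<bar>v - u\<bar>"
  unfolding interval_integral_eq_primitive[of f t u v, OF assms(1), symmetric]
  by (rule interval_integral_abs_le) (use assms in auto)

lemma primitive_cross_diff_le:
  assumes s: "continuous_on UNIV (f s)" and t: "continuous_on UNIV (f t)"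
    and bd: "\<And>x. x \<in> {c..d} \<Longrightarrow> \<bar>f s x - f t x\<bar> \<le> B"
    and "u \<in> {c..d}" "v \<in> {c..d}"
  shows "\<bar>(primitive f s v - primitive f s u) - (primitive f t v - primitive f t u)\<bar> \<le> B * \<bar>v - u\<bar>"
proof -
  have "(LBINT x=ereal u..ereal v. f s x - f t x)
      = (LBINT x=ereal u..ereal v. f s x) - (LBINT x=ereal u..ereal v. f t x)"
    by (intro interval_lebesgue_integral_diff interval_integrable_continuous s t)
  moreover have "\<bar>LBINT x=ereal u..ereal v. f s x - f t x\<bar> \<le> B * \<bar>v - u\<bar>"
    by (rule interval_integral_abs_le[OF _ bd]) (use assms in \<open>auto intro!: continuous_intros\<close>)
  ultimately show ?thesis
    by (simp only: interval_integral_eq_primitive[of f s u v, OF s]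
        interval_integral_eq_primitive[of f t u v, OF t])
qed

text \<open>
  The refinement identity for the sums that define the integral: the index range \<open>{A..<B}\<close> of
  level \<open>k\<close> becomes \<open>{2 * A..<2 * B}\<close>, and the first index of either range carries no increment.
\<close>
lemma dyadic_term_refinement:
  fixes f :: "real \<Rightarrow> real \<Rightarrow> real" and g :: "real \<Rightarrow> real" and A B k :: nat
  assumes cont: "\<And>t. t \<in> {0..1} \<Longrightarrow> continuous_on UNIV (f t)"
    and AB: "A < B" "B \<le> 2 ^ k"
  defines "h \<equiv> dyadic_mean g k" and "e \<equiv> \<lambda>n. dyadic_mean g (Suc k) (2 * n)"
    and "r \<equiv> \<lambda>n. dyadic_mean g (Suc k) (2 * n + 1)"
    and "P \<equiv> \<lambda>n. primitive f (dyadic k n)" and "Q \<equiv> \<lambda>n. primitive f (dyadic (Suc k) (2 * n + 1))"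
  shows "(\<Sum>m=Suc (2 * A)..<2 * B. dyadic_term f g (Suc k) m) - (\<Sum>n=Suc A..<B. dyadic_term f g k n)
    = (\<Sum>n=A..<B. ((Q n (h n) - Q n (e n)) - (P n (h n) - P n (e n)))
         + ((Q n (r n) - Q n (h n)) - (P (Suc n) (r n) - P (Suc n) (h n))))
      + (P A (h A) - P A (e A)) + (P B (r (B - 1)) - P B (h (B - 1)))"
proof -
  have odd: "dyadic_term f g (Suc k) (2 * n + 1) = Q n (r n) - Q n (e n)" if "n \<in> {A..<B}" for n
  proof -
    have "dyadic (Suc k) (2 * n + 1) \<in> {0..1}" using that AB by (intro dyadic_unit) auto
    from dyadic_term_eq_primitive[of f "Suc k" "2 * n + 1" g, OF cont[OF this]] show ?thesis
      by (simp add: Q_def r_def e_def)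
  qed
  have even: "dyadic_term f g (Suc k) (2 * n) = P n (e n) - P n (r (n - 1))" if "n \<in> {Suc A..<B}" for n
  proof -
    have "dyadic (Suc k) (2 * n) \<in> {0..1}" using that AB by (intro dyadic_unit) auto
    from dyadic_term_eq_primitive[of f "Suc k" "2 * n" g, OF cont[OF this]]
    have "dyadic_term f g (Suc k) (2 * n) = P n (e n) - P n (dyadic_mean g (Suc k) (2 * n - 1))"
      by (simp add: P_def e_def dyadic_double)
    moreover have "2 * n - 1 = 2 * (n - 1) + 1" using that by auto
    ultimately show ?thesis by (simp add: r_def)
  qed
  have coarse: "dyadic_term f g k n = P n (h n) - P n (h (n - 1))" if "n \<in> {Suc A..<B}" for n
  proof -
    have "dyadic k n \<in> {0..1}" using that AB by (intro dyadic_unit) auto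
    from dyadic_term_eq_primitive[of f k n g, OF cont[OF this]] show ?thesis
      by (simp add: P_def h_def)
  qed
  have "(\<Sum>n=A..<B. dyadic_term f g (Suc k) (2 * n + 1)) = (\<Sum>n=A..<B. Q n (r n) - Q n (e n))"
    by (rule sum.cong[OF refl odd])
  moreover have "(\<Sum>n=Suc A..<B. dyadic_term f g (Suc k) (2 * n)) = (\<Sum>n=Suc A..<B. P n (e n) - P n (r (n - 1)))"
    by (rule sum.cong[OF refl even])
  moreover have "(\<Sum>n=Suc A..<B. dyadic_term f g k n) = (\<Sum>n=Suc A..<B. P n (h n) - P n (h (n - 1)))"
    by (rule sum.cong[OF refl coarse])
  ultimately show ?thesis
    by (simp only: sum_odd_even_split[OF AB(1), of "dyadic_term f g (Suc k)"]
        refinement_identity[OF AB(1), of Q r e P h])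
qed

section \<open>The index ranges\<close>

text \<open>
  The cells of level \<open>k\<close> contained in \<open>[a, b]\<close> have the indices from \<open>first_cell a k\<close> up to, but
  excluding, \<open>end_cell b k\<close>.
\<close>
definition first_cell :: "real \<Rightarrow> nat \<Rightarrow> nat" where
  "first_cell a k = nat \<lceil>a * 2 ^ k\<rceil>"

definition end_cell :: "real \<Rightarrow> nat \<Rightarrow> nat" where
  "end_cell b k = nat \<lfloor>b * 2 ^ k\<rfloor>"

lemma end_cell_le:
  assumes "b \<le> 1"
  shows "end_cell b k \<le> 2 ^ k"
proof -
  have "b * 2 ^ k \<le> 1 * 2 ^ k" by (rule mult_right_mono[OF assms]) simp
  then have "b * 2 ^ k < real_of_int (2 ^ k) + 1"
    unfolding of_int_power of_int_numeral by linarith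
  then have "\<lfloor>b * 2 ^ k\<rfloor> \<le> 2 ^ k" by (simp only: floor_le_iff)
  then show ?thesis by (simp add: end_cell_def nat_le_iff)
qed

lemma index_set_Suc:
  assumes "0 \<le> a" "0 \<le> b" "b \<le> 1"
  shows "index_set a b (Suc k) = {2 * first_cell a k..<2 * end_cell b k}"
proof -
  have "n \<in> index_set a b (Suc k) \<longleftrightarrow> 2 * first_cell a k \<le> n \<and> n < 2 * end_cell b k" for n
  proof -
    have "dyadic k (n div 2) \<le> dyadic k (n div 2 + 1)" by (rule dyadic_mono) simp
    then have "n \<in> index_set a b (Suc k) \<longleftrightarrow>
        n \<le> 2 ^ Suc k \<and> a \<le> dyadic k (n div 2) \<and> dyadic k (n div 2 + 1) \<le> b"
      by (auto simp: index_set_def)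
    also have "a \<le> dyadic k (n div 2) \<longleftrightarrow> a * 2 ^ k \<le> of_int (int (n div 2))"
      by (simp add: dyadic_def field_simps)
    also have "\<dots> \<longleftrightarrow> first_cell a k \<le> n div 2"
      unfolding first_cell_def by (simp only: ceiling_le_iff[symmetric]) (simp add: nat_le_iff)
    also have "\<dots> \<longleftrightarrow> 2 * first_cell a k \<le> n" by linarith
    also have "dyadic k (n div 2 + 1) \<le> b \<longleftrightarrow> of_int (int (n div 2 + 1)) \<le> b * 2 ^ k"
      by (simp add: dyadic_def field_simps)
    also have "\<dots> \<longleftrightarrow> n div 2 + 1 \<le> end_cell b k"
      unfolding end_cell_def by (simp only: le_floor_iff[symmetric]) linarith
    also have "\<dots> \<longleftrightarrow> n < 2 * end_cell b k" by linarith
    finally show ?thesis using end_cell_le[OF assms(3), of k] by auto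
  qed
  then show ?thesis unfolding set_eq_iff atLeastLessThan_iff by blast
qed

lemma dyadic_sum_Suc:
  assumes "0 \<le> a" "0 \<le> b" "b \<le> 1"
  shows "dyadic_sum f g a b (Suc k) =
    (\<Sum>n=Suc (2 * first_cell a k)..<2 * end_cell b k. dyadic_term f g (Suc k) n)"
proof (cases "first_cell a k < end_cell b k")
  case True
  let ?I = "{2 * first_cell a k..<2 * end_cell b k}"
  have "Min ?I = 2 * first_cell a k" using True by (intro Min_eqI) auto
  moreover have "Max ?I = 2 * end_cell b k - 1" using True by (intro Max_eqI) auto
  moreover have "{2 * first_cell a k + 1..2 * end_cell b k - 1} = {Suc (2 * first_cell a k)..<2 * end_cell b k}"
    using True by auto
  ultimately show ?thesis
    using True unfolding dyadic_sum_def index_set_Suc[OF assms] dyadic_term_def by simp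
next
  case False
  then show ?thesis
    unfolding dyadic_sum_def index_set_Suc[OF assms] by simp
qed

lemma first_cell_Suc:
  assumes "0 \<le> a"
  shows "first_cell a (Suc k) \<le> 2 * first_cell a k"
    and "2 * first_cell a k \<le> first_cell a (Suc k) + 1"
proof -
  define y where "y = a * 2 ^ k"
  define c d where "c = \<lceil>y\<rceil>" and "d = \<lceil>2 * y\<rceil>"
  have c: "real_of_int c - 1 < y" "y \<le> real_of_int c"
    unfolding c_def by (rule ceiling_correct[THEN conjunct1], rule ceiling_correct[THEN conjunct2])
  have d: "real_of_int d - 1 < 2 * y" "2 * y \<le> real_of_int d"
    unfolding d_def by (rule ceiling_correct[THEN conjunct1], rule ceiling_correct[THEN conjunct2])
  have "0 \<le> y" using assms by (simp add: y_def)
  with c d have "real_of_int 0 \<le> real_of_int c" "real_of_int d < real_of_int (2 * c + 1)"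
    "real_of_int (2 * c) < real_of_int (d + 2)" by simp_all
  then have cd: "0 \<le> c" "d \<le> 2 * c" "2 * c \<le> d + 1"
    unfolding of_int_le_iff of_int_less_iff by simp_all
  have "first_cell a k = nat c" "first_cell a (Suc k) = nat d"
    by (simp_all add: first_cell_def c_def d_def y_def mult.left_commute)
  with cd show "first_cell a (Suc k) \<le> 2 * first_cell a k"
    "2 * first_cell a k \<le> first_cell a (Suc k) + 1" by simp_all
qed

lemma end_cell_Suc:
  assumes "0 \<le> b"
  shows "2 * end_cell b k \<le> end_cell b (Suc k)"
    and "end_cell b (Suc k) \<le> 2 * end_cell b k + 1"
proof -
  define y where "y = b * 2 ^ k"
  define c d where "c = \<lfloor>y\<rfloor>" and "d = \<lfloor>2 * y\<rfloor>"
  have c: "real_of_int c \<le> y" "y < real_of_int c + 1"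
    unfolding c_def by (rule floor_correct[THEN conjunct1]) (use floor_correct[of y] in simp)
  have d: "real_of_int d \<le> 2 * y" "2 * y < real_of_int d + 1"
    unfolding d_def by (rule floor_correct[THEN conjunct1]) (use floor_correct[of "2 * y"] in simp)
  have "0 \<le> y" using assms by (simp add: y_def)
  with c d have "real_of_int 0 < real_of_int (c + 1)" "real_of_int d < real_of_int (2 * c + 2)"
    "real_of_int (2 * c) < real_of_int (d + 1)" by simp_all
  then have cd: "0 \<le> c" "d \<le> 2 * c + 1" "2 * c \<le> d"
    unfolding of_int_le_iff of_int_less_iff by simp_all
  have "end_cell b k = nat c" "end_cell b (Suc k) = nat d"
    by (simp_all add: end_cell_def c_def d_def y_def mult.left_commute)
  with cd show "2 * end_cell b k \<le> end_cell b (Suc k)"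
    "end_cell b (Suc k) \<le> 2 * end_cell b k + 1" by simp_all
qed

lemma eventually_cells_nonempty:
  assumes "a < b" "0 \<le> a"
  shows "\<forall>\<^sub>F k in sequentially. first_cell a k < end_cell b k"
proof -
  obtain k0 where k0: "3 / (b - a) < (2::real) ^ k0"
    using real_arch_pow[of 2 "3 / (b - a)"] by auto
  have "\<forall>\<^sub>F k in sequentially. k0 \<le> k" by (rule eventually_ge_at_top)
  then show ?thesis
  proof eventually_elim
    case (elim k)
    define c d where "c = \<lceil>a * 2 ^ k\<rceil>" and "d = \<lfloor>b * 2 ^ k\<rfloor>"
    have c: "real_of_int c - 1 < a * 2 ^ k"
      unfolding c_def by (rule ceiling_correct[THEN conjunct1])
    have d: "b * 2 ^ k < real_of_int d + 1"
      unfolding d_def using floor_correct[of "b * 2 ^ k"] by simp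
    have "(2::real) ^ k0 \<le> 2 ^ k" using elim by (intro power_increasing) auto
    with k0 have "3 / (b - a) \<le> 2 ^ k" by linarith
    then have "3 + a * 2 ^ k \<le> b * 2 ^ k" using assms(1) by (simp add: field_simps)
    moreover have "0 \<le> a * 2 ^ k" using assms(2) by simp
    ultimately have "real_of_int (c + 1) < real_of_int d" "real_of_int 0 < real_of_int d"
      using c d by simp_all
    then have "c < d" "0 < d" unfolding of_int_less_iff by simp_all
    then show ?case by (simp add: first_cell_def end_cell_def c_def d_def)
  qed
qed

section \<open>A pathwise criterion for the existence of the integral\<close>

text \<open>
  When the mesh is halved, at most one new cell becomes available at each end of the interval; this
  adds at most two indices, hence two summands, on either side.
\<close>
lemma sum_extended_range_diff_le:
  fixes t :: "nat \<Rightarrow> real"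
  assumes "A' \<le> A" "A \<le> A' + 1" "A < B" "B \<le> B'" "B' \<le> B + 1"
    and bd: "\<And>m. m \<in> {Suc (2 * A')..<2 * B'} \<Longrightarrow> \<bar>t m\<bar> \<le> D" and D: "0 \<le> D"
  shows "\<bar>(\<Sum>m=Suc (2 * A')..<2 * B'. t m) - (\<Sum>m=Suc (2 * A)..<2 * B. t m)\<bar> \<le> 4 * D"
proof -
  have "(\<Sum>m=Suc (2 * A')..<2 * B'. t m) = (\<Sum>m=Suc (2 * A')..<Suc (2 * A). t m)
      + (\<Sum>m=Suc (2 * A)..<2 * B. t m) + (\<Sum>m=2 * B..<2 * B'. t m)"
  proof -
    have o: "Suc (2 * A') \<le> Suc (2 * A)" "Suc (2 * A) \<le> 2 * B" "2 * B \<le> 2 * B'"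
      using assms(1-5) by simp_all
    show ?thesis
      by (simp only: sum.atLeastLessThan_concat[OF o(1,2)] sum.atLeastLessThan_concat[OF order_trans[OF o(1,2)] o(3)])
  qed
  moreover have "\<bar>\<Sum>m=Suc (2 * A')..<Suc (2 * A). t m\<bar> \<le> 2 * D"
  proof -
    have "\<bar>\<Sum>m=Suc (2 * A')..<Suc (2 * A). t m\<bar> \<le> (\<Sum>m=Suc (2 * A')..<Suc (2 * A). D)"
      by (rule order_trans[OF sum_abs sum_mono]) (use assms(3,4) in \<open>auto intro: bd\<close>)
    also have "\<dots> = real (2 * A - 2 * A') * D" by simp
    also have "\<dots> \<le> 2 * D" using assms(2) D by (intro mult_right_mono) auto
    finally show ?thesis .
  qed
  moreover have "\<bar>\<Sum>m=2 * B..<2 * B'. t m\<bar> \<le> 2 * D"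
  proof -
    have "\<bar>\<Sum>m=2 * B..<2 * B'. t m\<bar> \<le> (\<Sum>m=2 * B..<2 * B'. D)"
      by (rule order_trans[OF sum_abs sum_mono]) (use assms(1,3) in \<open>auto intro: bd\<close>)
    also have "\<dots> = real (2 * B' - 2 * B) * D" by simp
    also have "\<dots> \<le> 2 * D" using assms(5) D by (intro mult_right_mono) auto
    finally show ?thesis .
  qed
  ultimately show ?thesis by linarith
qed

text \<open>
  Of the five single increments in the bound, four pay for the indices by which the range grows, and
  the fifth for the two half increments left over at the ends of the refinement identity.
\<close>
lemma dyadic_sum_step_le:
  fixes f :: "real \<Rightarrow> real \<Rightarrow> real" and g :: "real \<Rightarrow> real"
  assumes contg: "continuous_on {0..1} g"
    and contf: "\<And>t. t \<in> {0..1} \<Longrightarrow> continuous_on UNIV (f t)"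
    and gR: "\<And>t. t \<in> {0..1} \<Longrightarrow> \<bar>g t\<bar> \<le> R"
    and fM: "\<And>t x. t \<in> {0..1} \<Longrightarrow> x \<in> {-R..R} \<Longrightarrow> \<bar>f t x\<bar> \<le> M"
    and fC: "\<And>s t x. s \<in> {0..1} \<Longrightarrow> t \<in> {0..1} \<Longrightarrow> x \<in> {-R..R} \<Longrightarrow>
        \<bar>f s x - f t x\<bar> \<le> C * \<bar>s - t\<bar> powr \<beta>"
    and C: "0 \<le> C"
    and D: "\<And>m. 1 \<le> m \<Longrightarrow> m < 2 ^ Suc (Suc k) \<Longrightarrow> \<bar>mean_inc g (Suc (Suc k)) m\<bar> \<le> D"
    and ab: "0 \<le> a" "0 \<le> b" "b \<le> 1" "first_cell a k < end_cell b k"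
  shows "\<bar>dyadic_sum f g a b (Suc (Suc k)) - dyadic_sum f g a b (Suc k)\<bar>
    \<le> C * (1 / 2 ^ Suc (Suc k)) powr \<beta> * (\<Sum>m=1..<2 ^ Suc (Suc k). \<bar>mean_inc g (Suc (Suc k)) m\<bar>)
       + 5 * (M * D)"
proof -
  define K where "K = Suc k"
  define A B where "A = 2 * first_cell a k" and "B = 2 * end_cell b k"
  define h e r where "h = dyadic_mean g K" and "e = (\<lambda>n. dyadic_mean g (Suc K) (2 * n))"
    and "r = (\<lambda>n. dyadic_mean g (Suc K) (2 * n + 1))"
  define P Q where "P = (\<lambda>n. primitive f (dyadic K n))"
    and "Q = (\<lambda>n. primitive f (dyadic (Suc K) (2 * n + 1)))"
  define \<delta> where "\<delta> = C * (1 / 2 ^ Suc K) powr \<beta>"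
  have AB: "A < B" "B \<le> 2 ^ K"
    using ab end_cell_le[OF ab(3), of k] by (auto simp: A_def B_def K_def)
  have \<delta>: "0 \<le> \<delta>" using C by (simp add: \<delta>_def)
  have R: "0 \<le> R" using gR[of 0] by auto
  have M: "0 \<le> M" using fM[of 0 0] R by auto
  have "1 < (2::nat) ^ Suc (Suc k)" by (rule one_less_power) auto
  then have D0: "0 \<le> D" using D[of 1] by auto
  have mean: "dyadic_mean g j n \<in> {-R..R}" if "n < 2 ^ j" for j n
    using that gR by (intro dyadic_mean_bound contg)
  have halves: "h n = (e n + r n) / 2" if "n < 2 ^ K" for n
    unfolding h_def e_def r_def by (rule dyadic_mean_halves[OF contg that])
  have inc: "r n - e n = mean_inc g (Suc K) (2 * n + 1)" for n
    by (simp add: r_def e_def mean_inc_def)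
  have ran: "h n \<in> {-R..R}" "e n \<in> {-R..R}" "r n \<in> {-R..R}" if "n < 2 ^ K" for n
    using that mean unfolding h_def e_def r_def by auto
  have half_h: "\<bar>h n - e n\<bar> = \<bar>mean_inc g (Suc K) (2 * n + 1)\<bar> / 2"
    "\<bar>r n - h n\<bar> = \<bar>mean_inc g (Suc K) (2 * n + 1)\<bar> / 2" if "n < 2 ^ K" for n
  proof -
    have d: "h n - e n = mean_inc g (Suc K) (2 * n + 1) / 2" "r n - h n = mean_inc g (Suc K) (2 * n + 1) / 2"
      using halves[OF that] inc[of n] by (simp_all add: field_simps)
    show "\<bar>h n - e n\<bar> = \<bar>mean_inc g (Suc K) (2 * n + 1)\<bar> / 2"
      "\<bar>r n - h n\<bar> = \<bar>mean_inc g (Suc K) (2 * n + 1)\<bar> / 2"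
      unfolding d by simp_all
  qed
  have incD: "\<bar>mean_inc g (Suc K) (2 * n + 1)\<bar> \<le> D" if "n < 2 ^ K" for n
    using that unfolding K_def by (intro D) auto
  have S: "dyadic_sum f g a b (Suc k) = (\<Sum>n=Suc A..<B. dyadic_term f g K n)"
    by (simp add: dyadic_sum_Suc[OF ab(1-3)] A_def B_def K_def)
  have S': "dyadic_sum f g a b (Suc (Suc k)) =
      (\<Sum>m=Suc (2 * first_cell a K)..<2 * end_cell b K. dyadic_term f g (Suc K) m)"
    by (simp add: dyadic_sum_Suc[OF ab(1-3)] K_def)
  have termD: "\<bar>dyadic_term f g (Suc K) m\<bar> \<le> M * D" if m: "1 \<le> m" "m < 2 ^ Suc K" for m
  proof -
    have "\<bar>dyadic_term f g (Suc K) m\<bar> \<le> M * \<bar>mean_inc g (Suc K) m\<bar>"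
      unfolding dyadic_term_def mean_inc_def
    proof (rule interval_integral_abs_le[of _ "-R" R])
      have t: "dyadic (Suc K) m \<in> {0..1}" using m by (intro dyadic_unit) auto
      then show "continuous_on UNIV (f (dyadic (Suc K) m))" by (rule contf)
      show "\<bar>f (dyadic (Suc K) m) x\<bar> \<le> M" if "x \<in> {-R..R}" for x using fM[OF t that] .
    qed (use m in \<open>intro mean; simp\<close>)+
    also have "\<dots> \<le> M * D" using D[of m] m M by (intro mult_left_mono) (auto simp: K_def)
    finally show ?thesis .
  qed
  have ext: "\<bar>dyadic_sum f g a b (Suc (Suc k)) - (\<Sum>m=Suc (2 * A)..<2 * B. dyadic_term f g (Suc K) m)\<bar>
      \<le> 4 * (M * D)"
    unfolding S'
  proof (rule sum_extended_range_diff_le)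
    show "\<bar>dyadic_term f g (Suc K) m\<bar> \<le> M * D"
      if "m \<in> {Suc (2 * first_cell a K)..<2 * end_cell b K}" for m
    proof (rule termD)
      show "m < 2 ^ Suc K" using that end_cell_le[OF ab(3), of K] by simp
    qed (use that in simp)
  qed (use first_cell_Suc[OF ab(1), of k] end_cell_Suc[OF ab(2), of k] AB(1) M D0
        in \<open>simp_all add: A_def B_def K_def\<close>)
  have close: "\<bar>(primitive f s v - primitive f s u) - (primitive f t v - primitive f t u)\<bar> \<le> \<delta> * \<bar>v - u\<bar>"
    if st: "s \<in> {0..1}" "t \<in> {0..1}" "\<bar>s - t\<bar> = 1 / 2 ^ Suc K" and uv: "u \<in> {-R..R}" "v \<in> {-R..R}"
    for s t u v
  proof (rule primitive_cross_diff_le[OF contf[OF st(1)] contf[OF st(2)] _ uv])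
    show "\<bar>f s x - f t x\<bar> \<le> \<delta>" if "x \<in> {-R..R}" for x
      using fC[OF st(1,2) that] by (simp add: \<delta>_def st(3))
  qed
  have cell: "\<bar>((Q n (h n) - Q n (e n)) - (P n (h n) - P n (e n)))
         + ((Q n (r n) - Q n (h n)) - (P (Suc n) (r n) - P (Suc n) (h n)))\<bar>
       \<le> \<delta> * \<bar>mean_inc g (Suc K) (2 * n + 1)\<bar>" if n: "n < 2 ^ K" for n
  proof -
    have u: "dyadic K n \<in> {0..1}" "dyadic K (Suc n) \<in> {0..1}" "dyadic (Suc K) (2 * n + 1) \<in> {0..1}"
      by (rule dyadic_unit, use n in simp)+
    have "dyadic (Suc K) (2 * n + 1) = dyadic K n + 1 / 2 ^ Suc K"
      using dyadic_Suc[of "Suc K" "2 * n"] by (simp add: dyadic_double)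
    then have dist: "\<bar>dyadic (Suc K) (2 * n + 1) - dyadic K n\<bar> = 1 / 2 ^ Suc K"
      "\<bar>dyadic (Suc K) (2 * n + 1) - dyadic K (Suc n)\<bar> = 1 / 2 ^ Suc K"
      by (simp_all add: dyadic_Suc field_simps)
    have "\<bar>(Q n (h n) - Q n (e n)) - (P n (h n) - P n (e n))\<bar> \<le> \<delta> * \<bar>h n - e n\<bar>"
      unfolding P_def Q_def using u dist ran[OF n] by (intro close)
    moreover have "\<bar>(Q n (r n) - Q n (h n)) - (P (Suc n) (r n) - P (Suc n) (h n))\<bar> \<le> \<delta> * \<bar>r n - h n\<bar>"
      unfolding P_def Q_def using u dist ran[OF n] by (intro close)
    ultimately show ?thesis unfolding half_h[OF n] by linarith
  qed
  have edge: "\<bar>primitive f (dyadic K n) v - primitive f (dyadic K n) u\<bar> \<le> M * D / 2"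
    if n: "n \<le> 2 ^ K" and uv: "u \<in> {-R..R}" "v \<in> {-R..R}" and "\<bar>v - u\<bar> \<le> D / 2" for n u v
  proof -
    have t: "dyadic K n \<in> {0..1}" using n by (rule dyadic_unit)
    have "\<bar>primitive f (dyadic K n) v - primitive f (dyadic K n) u\<bar> \<le> M * \<bar>v - u\<bar>"
      by (rule primitive_diff_le[of f "dyadic K n", OF contf[OF t] fM[OF t] uv])
    also have "\<dots> \<le> M * (D / 2)" using that(4) M by (rule mult_left_mono)
    finally show ?thesis by simp
  qed
  have edges: "\<bar>P A (h A) - P A (e A)\<bar> \<le> M * D / 2" "\<bar>P B (r (B - 1)) - P B (h (B - 1))\<bar> \<le> M * D / 2"
  proof -
    have n: "A < 2 ^ K" "B - 1 < 2 ^ K" using AB by simp_all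
    have "\<bar>h A - e A\<bar> \<le> D / 2" "\<bar>r (B - 1) - h (B - 1)\<bar> \<le> D / 2"
      unfolding half_h[OF n(1)] half_h[OF n(2)] using incD[OF n(1)] incD[OF n(2)] by simp_all
    then show "\<bar>P A (h A) - P A (e A)\<bar> \<le> M * D / 2" "\<bar>P B (r (B - 1)) - P B (h (B - 1))\<bar> \<le> M * D / 2"
      unfolding P_def using n AB(2) by (auto intro!: edge simp only: ran less_imp_le)
  qed
  have "\<bar>\<Sum>n=A..<B. ((Q n (h n) - Q n (e n)) - (P n (h n) - P n (e n)))
         + ((Q n (r n) - Q n (h n)) - (P (Suc n) (r n) - P (Suc n) (h n)))\<bar>
      \<le> (\<Sum>n=A..<B. \<delta> * \<bar>mean_inc g (Suc K) (2 * n + 1)\<bar>)"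
    by (rule order_trans[OF sum_abs sum_mono], rule cell) (use AB in auto)
  also have "\<dots> = \<delta> * (\<Sum>m\<in>(\<lambda>n. 2 * n + 1) ` {A..<B}. \<bar>mean_inc g (Suc K) m\<bar>)"
    by (subst sum.reindex) (auto simp: inj_on_def sum_distrib_left)
  also have "\<dots> \<le> \<delta> * (\<Sum>m=1..<2 ^ Suc K. \<bar>mean_inc g (Suc K) m\<bar>)"
    using AB \<delta> by (intro mult_left_mono sum_mono2) auto
  finally have main: "\<bar>\<Sum>n=A..<B. ((Q n (h n) - Q n (e n)) - (P n (h n) - P n (e n)))
         + ((Q n (r n) - Q n (h n)) - (P (Suc n) (r n) - P (Suc n) (h n)))\<bar>
      \<le> \<delta> * (\<Sum>m=1..<2 ^ Suc K. \<bar>mean_inc g (Suc K) m\<bar>)" .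
  have "\<bar>(\<Sum>m=Suc (2 * A)..<2 * B. dyadic_term f g (Suc K) m) - dyadic_sum f g a b (Suc k)\<bar>
      \<le> \<delta> * (\<Sum>m=1..<2 ^ Suc K. \<bar>mean_inc g (Suc K) m\<bar>) + M * D"
    using dyadic_term_refinement[of f A B K g, OF contf AB] main edges
    unfolding S P_def Q_def h_def e_def r_def by linarith
  with ext show ?thesis unfolding \<delta>_def K_def by linarith
qed

lemma holder2_continuous_snd:
  assumes "f \<in> holder2 \<beta>" "t \<in> {0..1}"
  shows "continuous_on UNIV (f t)"
proof -
  have "continuous_on ({0..1} \<times> UNIV) (\<lambda>(t, x). f t x)" using assms by (simp add: holder2_def)
  then have "continuous_on UNIV (\<lambda>x. (\<lambda>(t, x). f t x) (t, x))"
    by (rule continuous_on_compose2) (use assms(2) in \<open>auto intro!: continuous_intros\<close>)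
  then show ?thesis by simp
qed

lemma holder2_bounded_on_strip:
  assumes "f \<in> holder2 \<beta>"
  obtains M where "\<And>t x. t \<in> {0..1} \<Longrightarrow> x \<in> {c..d} \<Longrightarrow> \<bar>f t x\<bar> \<le> M"
proof -
  have "continuous_on ({0..1} \<times> {c..d}) (\<lambda>(t, x). f t x)"
    using assms by (auto simp: holder2_def intro: continuous_on_subset)
  then have "compact ((\<lambda>(t, x). f t x) ` ({0..1} \<times> {c..d}))"
    by (intro compact_continuous_image compact_Times compact_Icc)
  then have "bounded ((\<lambda>(t, x). f t x) ` ({0..1} \<times> {c..d}))" by (rule compact_imp_bounded)
  then obtain M where "\<And>y. y \<in> (\<lambda>(t, x). f t x) ` ({0..1} \<times> {c..d}) \<Longrightarrow> norm y \<le> M"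
    unfolding bounded_iff by blast
  then show ?thesis by (intro that[of M]) force
qed

text \<open>
  The step from one level to the next costs at most the variation of \<open>f\<close> in time, which is of
  order \<open>2 powr (- \<beta> k)\<close>, times the variation of the staircase of dyadic means; the end
  points of the index range contribute a bounded number of single increments.
\<close>
lemma dg_integrable_if_variation_summable:
  assumes f: "f \<in> holder2 \<beta>" and contg: "continuous_on {0..1} g"
    and ab: "0 \<le> a" "a < b" "b \<le> 1"
    and var: "summable (\<lambda>k. (1 / 2 ^ k) powr \<beta> * (\<Sum>m=1..<2 ^ k. \<bar>mean_inc g k m\<bar>))"
    and D: "summable D" "\<And>k m. 1 \<le> m \<Longrightarrow> m < 2 ^ k \<Longrightarrow> \<bar>mean_inc g k m\<bar> \<le> D k"
  shows "dg_integrable f g a b"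
proof -
  have "bounded (g ` {0..1})"
    by (intro compact_imp_bounded compact_continuous_image contg compact_Icc)
  then obtain R where R: "\<And>t. t \<in> {0..1} \<Longrightarrow> \<bar>g t\<bar> \<le> R"
    unfolding bounded_iff real_norm_def by blast
  have "0 \<le> R" by (rule order_trans[OF abs_ge_zero R[of 0]]) simp
  then have "- R \<le> R" by simp
  then obtain C where C: "0 \<le> C"
    "\<And>s t x. s \<in> {0..1} \<Longrightarrow> t \<in> {0..1} \<Longrightarrow> x \<in> {-R..R} \<Longrightarrow> \<bar>f s x - f t x\<bar> \<le> C * \<bar>s - t\<bar> powr \<beta>"
    using holder2_local_bound[OF f] by metis
  obtain M where M: "\<And>t x. t \<in> {0..1} \<Longrightarrow> x \<in> {-R..R} \<Longrightarrow> \<bar>f t x\<bar> \<le> M"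
    using holder2_bounded_on_strip[OF f] by metis
  define bound where "bound k = C * ((1 / 2 ^ k) powr \<beta> * (\<Sum>m=1..<2 ^ k. \<bar>mean_inc g k m\<bar>))
      + 5 * (M * D k)" for k
  have step: "norm (dyadic_sum f g a b (Suc (Suc k)) - dyadic_sum f g a b (Suc k)) \<le> bound (Suc (Suc k))"
    if k: "first_cell a k < end_cell b k" for k
  proof -
    have "\<bar>dyadic_sum f g a b (Suc (Suc k)) - dyadic_sum f g a b (Suc k)\<bar>
        \<le> C * (1 / 2 ^ Suc (Suc k)) powr \<beta> * (\<Sum>m=1..<2 ^ Suc (Suc k). \<bar>mean_inc g (Suc (Suc k)) m\<bar>)
         + 5 * (M * D (Suc (Suc k)))"
      using ab holder2_continuous_snd[OF f]
      by (intro dyadic_sum_step_le[OF contg _ R M C(2) C(1) D(2) _ _ _ k]) auto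
    then show ?thesis by (simp only: bound_def mult.assoc real_norm_def)
  qed
  have "summable bound"
    unfolding bound_def by (intro summable_add summable_mult var D)
  then have "summable (\<lambda>k. bound (Suc (Suc k)))"
    using summable_Suc_iff[of bound] summable_Suc_iff[of "\<lambda>k. bound (Suc k)"] by blast
  moreover have "\<forall>\<^sub>F k in sequentially.
      norm (dyadic_sum f g a b (Suc (Suc k)) - dyadic_sum f g a b (Suc k)) \<le> bound (Suc (Suc k))"
    using eventually_cells_nonempty[OF ab(2,1)] by eventually_elim (rule step)
  ultimately have "summable (\<lambda>k. dyadic_sum f g a b (Suc (Suc k)) - dyadic_sum f g a b (Suc k))"
    by (rule summable_comparison_test_ev[rotated])
  then have "convergent (\<lambda>n. \<Sum>k<n. dyadic_sum f g a b (Suc (Suc k)) - dyadic_sum f g a b (Suc k))"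
    by (simp add: summable_iff_convergent)
  then have "convergent (\<lambda>n. dyadic_sum f g a b (Suc n) - dyadic_sum f g a b (Suc 0))"
    unfolding sum_lessThan_telescope[of "\<lambda>n. dyadic_sum f g a b (Suc n)"] .
  then have "convergent (\<lambda>n. dyadic_sum f g a b (Suc n) - dyadic_sum f g a b (Suc 0) + dyadic_sum f g a b (Suc 0))"
    by (intro convergent_add convergent_const)
  then have "convergent (dyadic_sum f g a b)"
    by (simp add: convergent_Suc_iff)
  then show ?thesis by (simp add: convergent_def dg_integrable_def has_dg_integral_def)
qed

text \<open>
  This trades a first power for a fourth power, whose expectation is explicit; it is efficient when
  \<open>l\<close> is of the order of \<open>x\<close>.
\<close>
lemma abs_le_quartic:
  fixes x l :: real
  assumes "0 < l"
  shows "\<bar>x\<bar> \<le> l + x ^ 4 / l ^ 3"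
proof (cases "\<bar>x\<bar> \<le> l")
  case True
  then show ?thesis using assms by (simp add: add_increasing2)
next
  case False
  then have "l ^ 3 * \<bar>x\<bar> \<le> \<bar>x\<bar> ^ 3 * \<bar>x\<bar>"
    using assms by (intro mult_right_mono power_mono) auto
  also have "\<dots> = x ^ 4" by (simp add: power3_eq_cube power4_eq_xxxx flip: abs_mult)
  finally have "\<bar>x\<bar> \<le> x ^ 4 / l ^ 3" using assms by (simp add: field_simps)
  with assms show ?thesis by simp
qed

text \<open>
  A bound on the quartic variation which is worse than the expected order \<open>2 powr (- k)\<close> only by
  a factor \<open>2 powr (\<eta> k)\<close> controls both the total variation and the single increments of the
  staircase; the loss \<open>\<eta>\<close> is absorbed by the gap between \<open>\<beta>\<close> and 1/2.
\<close>
lemma dg_integrable_if_quartic_variation_bound: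
  assumes f: "f \<in> holder2 \<beta>" and contg: "continuous_on {0..1} g"
    and ab: "0 \<le> a" "a < b" "b \<le> 1"
    and \<eta>: "0 < \<eta>" "\<eta> \<le> 1 / 4" "1 / 2 + 2 * \<eta> \<le> \<beta>"
    and V: "\<And>k. (\<Sum>m=1..<2 ^ k. mean_inc g k m ^ 4) \<le> K * 2 powr (- (1 - \<eta>) * real k)"
  shows "dg_integrable f g a b"
proof (rule dg_integrable_if_variation_summable[OF f contg ab])
  have K: "0 \<le> K"
  proof -
    have "0 \<le> (\<Sum>m=1..<2 ^ 0. mean_inc g 0 m ^ 4)" by simp
    also have "\<dots> \<le> K" using V[of 0] by simp
    finally show ?thesis .
  qed
  have geo: "summable (\<lambda>k. c * 2 powr (- x * real k))" if "0 < x" for c x :: real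
  proof -
    have "summable (\<lambda>k. (2 powr (- x)) ^ k)"
      using that by (intro summable_geometric) (simp add: powr_minus divide_simps)
    then show ?thesis by (intro summable_mult) (simp add: powr_realpow[symmetric] powr_powr)
  qed
  show "summable (\<lambda>k. (1 / 2 ^ k) powr \<beta> * (\<Sum>m=1..<2 ^ k. \<bar>mean_inc g k m\<bar>))"
  proof (rule summable_comparison_test'[OF geo[OF \<eta>(1), of "1 + K"]])
    fix k :: nat
    define l where "l = 2 powr (- real k / 2)"
    have l: "0 < l" by (simp add: l_def)
    have l3: "l ^ 3 = 2 powr (- 3 * real k / 2)"
      by (simp add: l_def powr_realpow[symmetric] powr_powr mult.commute)
    have "(\<Sum>m=1..<2 ^ k. \<bar>mean_inc g k m\<bar>) \<le> (\<Sum>m=1..<2 ^ k. l + mean_inc g k m ^ 4 / l ^ 3)"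
      by (rule sum_mono) (rule abs_le_quartic[OF l])
    also have "\<dots> = real (2 ^ k - 1) * l + (\<Sum>m=1..<2 ^ k. mean_inc g k m ^ 4) / l ^ 3"
      by (simp add: sum.distrib sum_divide_distrib)
    also have "\<dots> \<le> 2 ^ k * l + K * 2 powr (- (1 - \<eta>) * real k) / l ^ 3"
      using l by (intro add_mono mult_right_mono divide_right_mono V) auto
    also have "\<dots> = 2 powr (real k / 2) + K * 2 powr (real k / 2 + \<eta> * real k)"
    proof -
      have "2 ^ k * l = 2 powr (real k / 2)"
        unfolding l_def powr_realpow[symmetric, of 2 k, simplified] powr_add[symmetric] by simp
      moreover have "2 powr (- (1 - \<eta>) * real k) / l ^ 3 = 2 powr (real k / 2 + \<eta> * real k)"
        unfolding l3 powr_diff[symmetric] by (simp add: algebra_simps)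
      ultimately show ?thesis by (simp only: times_divide_eq_right[symmetric])
    qed
    also have "\<dots> \<le> 1 * 2 powr (real k / 2 + \<eta> * real k) + K * 2 powr (real k / 2 + \<eta> * real k)"
      using \<eta>(1) by (intro add_right_mono) simp
    finally have "(\<Sum>m=1..<2 ^ k. \<bar>mean_inc g k m\<bar>) \<le> (1 + K) * 2 powr (real k / 2 + \<eta> * real k)"
      by (simp add: algebra_simps)
    moreover have "(1 / 2 ^ k) powr \<beta> \<le> 2 powr (- (1 / 2 + 2 * \<eta>) * real k)"
    proof -
      have "(1 / 2 ^ k) powr \<beta> = 2 powr (- \<beta> * real k)"
        by (simp add: powr_divide powr_minus_divide powr_powr powr_realpow[symmetric] mult.commute)
      also have "\<dots> \<le> 2 powr (- (1 / 2 + 2 * \<eta>) * real k)"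
        using \<eta>(3) by (intro powr_mono mult_right_mono) auto
      finally show ?thesis .
    qed
    ultimately have "(1 / 2 ^ k) powr \<beta> * (\<Sum>m=1..<2 ^ k. \<bar>mean_inc g k m\<bar>)
      \<le> 2 powr (- (1 / 2 + 2 * \<eta>) * real k) * ((1 + K) * 2 powr (real k / 2 + \<eta> * real k))"
      by (intro mult_mono sum_nonneg) auto
    also have "\<dots> = (1 + K) * 2 powr (- (1 / 2 + 2 * \<eta>) * real k + (real k / 2 + \<eta> * real k))"
      unfolding powr_add by simp
    also have "- (1 / 2 + 2 * \<eta>) * real k + (real k / 2 + \<eta> * real k) = - \<eta> * real k"
      by (simp add: field_simps)
    finally show "norm ((1 / 2 ^ k) powr \<beta> * (\<Sum>m=1..<2 ^ k. \<bar>mean_inc g k m\<bar>)) \<le> (1 + K) * 2 powr (- \<eta> * real k)"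
      by (simp add: abs_mult sum_nonneg)
  qed
  show "summable (\<lambda>k. (1 + K) * 2 powr (- (1 / 8) * real k))"
    by (rule geo) simp
  fix k m :: nat assume m: "1 \<le> m" "m < 2 ^ k"
  define l where "l = 2 powr (- (1 / 8) * real k)"
  have l: "0 < l" by (simp add: l_def)
  have "mean_inc g k m ^ 4 \<le> (\<Sum>m=1..<2 ^ k. mean_inc g k m ^ 4)"
    using m by (intro member_le_sum) auto
  also have "\<dots> \<le> K * 2 powr (- (1 - \<eta>) * real k)" by (rule V)
  also have "\<dots> \<le> K * 2 powr (- (1 / 2) * real k)"
    using K \<eta>(2) by (intro mult_left_mono powr_mono mult_right_mono) auto
  also have "\<dots> = K * l ^ 4"
    by (simp add: l_def powr_realpow[symmetric] powr_powr)
  finally have q: "mean_inc g k m ^ 4 \<le> K * l ^ 4" .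
  have "\<bar>mean_inc g k m\<bar> \<le> l + mean_inc g k m ^ 4 / l ^ 3" by (rule abs_le_quartic[OF l])
  also have "\<dots> \<le> l + K * l ^ 4 / l ^ 3" using l q by (intro add_left_mono divide_right_mono) auto
  also have "\<dots> = (1 + K) * l" using l by (simp add: field_simps power_def numeral_eq_Suc)
  finally show "\<bar>mean_inc g k m\<bar> \<le> (1 + K) * 2 powr (- (1 / 8) * real k)" by (simp add: l_def)
qed

section \<open>A Hoelder function of exponent 1/2 resonating with a given path\<close>

definition tent :: "real \<Rightarrow> real" where
  "tent u = 1 - \<bar>2 * frac u - 1\<bar>"

text \<open>One level of a Faber-Schauder expansion, rescaled to unit cells, with coefficient \<open>s m\<close> on \<open>[m, m + 1]\<close>.\<close>
definition schauder_layer :: "(int \<Rightarrow> real) \<Rightarrow> real \<Rightarrow> real" where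
  "schauder_layer s u = s \<lfloor>u\<rfloor> * tent u"

lemma tent_bounds: "0 \<le> tent u" "tent u \<le> 1"
  unfolding tent_def using frac_ge_0[of u] frac_lt_1[of u] by linarith+

lemma schauder_layer_left:
  assumes "real_of_int m \<le> u" "u \<le> real_of_int m + 1 / 2"
  shows "schauder_layer s u = s m * (2 * (u - real_of_int m))"
proof -
  have "\<lfloor>u\<rfloor> = m" using assms by (intro floor_unique) auto
  then show ?thesis using assms by (simp add: schauder_layer_def tent_def frac_def)
qed

lemma schauder_layer_right:
  assumes "real_of_int m + 1 / 2 \<le> u" "u \<le> real_of_int m + 1"
  shows "schauder_layer s u = s m * (2 - 2 * (u - real_of_int m))"
proof (cases "u = real_of_int m + 1")
  case True
  then show ?thesis by (simp add: schauder_layer_def tent_def)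
next
  case False
  then have "\<lfloor>u\<rfloor> = m" using assms by (intro floor_unique) auto
  then show ?thesis using assms by (simp add: schauder_layer_def tent_def frac_def)
qed

lemma schauder_layer_int: "schauder_layer s (real_of_int m) = 0"
  by (simp add: schauder_layer_def tent_def)

lemma schauder_layer_nat: "schauder_layer s (real m) = 0"
  using schauder_layer_int[of s "int m"] by simp

lemma schauder_layer_abs_le:
  assumes "\<And>m. \<bar>s m\<bar> \<le> 1"
  shows "\<bar>schauder_layer s u\<bar> \<le> 1"
  using assms[of "\<lfloor>u\<rfloor>"] tent_bounds[of u] by (simp add: schauder_layer_def abs_mult mult_le_one)

lemma schauder_layer_lipschitz:
  assumes s: "\<And>m. \<bar>s m\<bar> \<le> 1"
  shows "\<bar>schauder_layer s u - schauder_layer s v\<bar> \<le> 2 * \<bar>u - v\<bar>"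
proof -
  have near: "\<bar>schauder_layer s x\<bar> \<le> 2 * (x - real_of_int \<lfloor>x\<rfloor>)"
      "\<bar>schauder_layer s x\<bar> \<le> 2 * (real_of_int \<lfloor>x\<rfloor> + 1 - x)" for x
  proof -
    have t: "tent x \<le> 2 * (x - real_of_int \<lfloor>x\<rfloor>)" "tent x \<le> 2 * (real_of_int \<lfloor>x\<rfloor> + 1 - x)"
      by (auto simp: tent_def frac_def)
    have "\<bar>schauder_layer s x\<bar> \<le> 1 * tent x"
      unfolding schauder_layer_def abs_mult using s[of "\<lfloor>x\<rfloor>"] tent_bounds(1)[of x]
      by (intro mult_mono) auto
    with t show "\<bar>schauder_layer s x\<bar> \<le> 2 * (x - real_of_int \<lfloor>x\<rfloor>)"
      "\<bar>schauder_layer s x\<bar> \<le> 2 * (real_of_int \<lfloor>x\<rfloor> + 1 - x)" by linarith+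
  qed
  have main: "\<bar>schauder_layer s u - schauder_layer s v\<bar> \<le> 2 * (v - u)" if "u \<le> v" for u v
  proof (cases "\<lfloor>u\<rfloor> = \<lfloor>v\<rfloor>")
    case True
    then have "\<bar>tent u - tent v\<bar> \<le> 2 * (v - u)"
      using that by (auto simp: tent_def frac_def)
    moreover have "\<bar>schauder_layer s u - schauder_layer s v\<bar> \<le> \<bar>tent u - tent v\<bar>"
    proof -
      have "\<bar>schauder_layer s u - schauder_layer s v\<bar> = \<bar>s \<lfloor>v\<rfloor>\<bar> * \<bar>tent u - tent v\<bar>"
        by (simp add: schauder_layer_def True right_diff_distrib[symmetric] abs_mult)
      also have "\<dots> \<le> 1 * \<bar>tent u - tent v\<bar>"
        using s by (intro mult_right_mono) auto
      finally show ?thesis by simp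
    qed
    ultimately show ?thesis by (rule order_trans[rotated])
  next
    case False
    with that have "\<lfloor>u\<rfloor> + 1 \<le> \<lfloor>v\<rfloor>" using floor_mono[OF that] by linarith
    then have "real_of_int (\<lfloor>u\<rfloor> + 1) \<le> real_of_int \<lfloor>v\<rfloor>" by (rule of_int_le_iff[THEN iffD2])
    then have fl: "real_of_int \<lfloor>u\<rfloor> + 1 \<le> real_of_int \<lfloor>v\<rfloor>" by simp
    show ?thesis using near(2)[of u] near(1)[of v] fl by argo
  qed
  show ?thesis
  proof (cases "u \<le> v")
    case True
    with main[of u v] show ?thesis by simp
  next
    case False
    with main[of v u] show ?thesis by (simp add: abs_minus_commute)
  qed
qed

definition schauder_series :: "(nat \<Rightarrow> int \<Rightarrow> real) \<Rightarrow> real \<Rightarrow> real" where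
  "schauder_series \<sigma> t = (\<Sum>j. (1 / sqrt 2) ^ j * schauder_layer (\<sigma> j) (2 ^ j * t))"

lemma inverse_sqrt2_bounds: "0 < 1 / sqrt 2" "1 / sqrt 2 < 1"
  by (simp_all add: real_less_lsqrt)

lemma schauder_series_summable:
  assumes "\<And>j m. \<bar>\<sigma> j m\<bar> \<le> 1"
  shows "summable (\<lambda>j. (1 / sqrt 2) ^ j * schauder_layer (\<sigma> j) (2 ^ j * t))"
proof (rule summable_comparison_test')
  show "summable (\<lambda>j. (1 / sqrt 2) ^ j)"
    using inverse_sqrt2_bounds by (intro summable_geometric) simp
  show "norm ((1 / sqrt 2) ^ j * schauder_layer (\<sigma> j) (2 ^ j * t)) \<le> (1 / sqrt 2) ^ j" for j
    using schauder_layer_abs_le[of "\<sigma> j" "2 ^ j * t"] assms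
    by (simp add: abs_mult power_abs divide_right_mono power_divide)
qed

lemma schauder_series_nat: "schauder_series \<sigma> (real n) = 0"
proof -
  have "schauder_layer (\<sigma> j) (2 ^ j * real n) = 0" for j
    using schauder_layer_nat[of "\<sigma> j" "2 ^ j * n"] by simp
  then show ?thesis by (simp add: schauder_series_def)
qed

text \<open>
  The \<open>j\<close>-th layer has height at most \<open>2 powr (- j / 2)\<close> and Lipschitz constant at most
  \<open>2 * 2 powr (j / 2)\<close>.  For two points at distance \<open>\<delta>\<close> the Lipschitz bound is used for the
  layers with \<open>2 ^ j < 1 / \<delta>\<close> and the height for the others; both parts are geometric sums
  dominated by the layer with \<open>2 ^ j\<close> close to \<open>1 / \<delta>\<close>.
\<close>
lemma schauder_series_holder_half:
  assumes \<sigma>: "\<And>j m. \<bar>\<sigma> j m\<bar> \<le> 1"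
  obtains C where "0 \<le> C"
    "\<And>s t. s \<in> {0..1} \<Longrightarrow> t \<in> {0..1} \<Longrightarrow>
       \<bar>schauder_series \<sigma> s - schauder_series \<sigma> t\<bar> \<le> C * \<bar>s - t\<bar> powr (1 / 2)"
proof -
  define q where "q = sqrt 2"
  have q: "1 < q" "q\<^sup>2 = 2" by (simp_all add: q_def)
  define C where "C = 4 * q / (q - 1)"
  have C_half: "C / 2 = 2 * q / (q - 1)" using q by (simp add: C_def field_simps)
  have C0: "0 \<le> C" using q by (simp add: C_def)
  have bound: "\<bar>schauder_series \<sigma> s - schauder_series \<sigma> t\<bar> \<le> C * \<bar>s - t\<bar> powr (1 / 2)"
    if st: "s \<in> {0..1}" "t \<in> {0..1}" "s \<noteq> t" for s t
  proof -
    define d where "d = \<bar>s - t\<bar>"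
    have d: "0 < d" "d \<le> 1" using st by (auto simp: d_def)
    \<comment> \<open>The level at which the mesh passes below the distance of the two points.\<close>
    obtain J where J: "1 / 2 ^ J \<le> d" "d \<le> 2 / 2 ^ J"
    proof -
      have ex: "\<exists>J. (1::real) / 2 ^ J \<le> d"
        using real_arch_pow_inv[of d "1 / 2"] d by (auto simp: power_divide intro: less_imp_le)
      define J where "J = (LEAST J. (1::real) / 2 ^ J \<le> d)"
      have 1: "1 / 2 ^ J \<le> d" unfolding J_def by (rule LeastI_ex[OF ex])
      have 2: "d \<le> 2 / 2 ^ J"
      proof (cases J)
        case 0
        then show ?thesis using d by simp
      next
        case (Suc i)
        then have "\<not> (1::real) / 2 ^ i \<le> d" unfolding J_def by (intro not_less_Least) simp
        then show ?thesis using Suc by simp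
      qed
      from 1 2 show thesis by (rule that)
    qed
    have q2: "q ^ (2 * j) = 2 ^ j" for j using q by (simp add: power_mult)
    have qJ: "(q ^ J)\<^sup>2 = 2 ^ J"
      by (subst power_mult[symmetric], subst mult.commute, rule q2)
    have low: "1 / q ^ J \<le> sqrt d"
    proof (rule real_le_rsqrt)
      show "(1 / q ^ J)\<^sup>2 \<le> d" using J(1) by (simp add: power_divide qJ)
    qed
    have high: "q ^ J * d \<le> q * sqrt d"
    proof -
      have "(q ^ J * sqrt d)\<^sup>2 = 2 ^ J * d"
        unfolding power_mult_distrib qJ using d by simp
      also have "\<dots> \<le> q\<^sup>2" unfolding q(2) using J(2) by (simp add: field_simps)
      finally have "q ^ J * sqrt d \<le> q" by (rule power2_le_imp_le) (use q in simp)
      then have "q ^ J * sqrt d * sqrt d \<le> q * sqrt d" using d by (intro mult_right_mono) auto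
      then show ?thesis using d by (simp add: mult.assoc)
    qed
    define a where "a j = (1 / sqrt 2) ^ j * schauder_layer (\<sigma> j) (2 ^ j * s)
        - (1 / sqrt 2) ^ j * schauder_layer (\<sigma> j) (2 ^ j * t)" for j
    have sa: "summable a" unfolding a_def by (intro summable_diff schauder_series_summable \<sigma>)
    have "schauder_series \<sigma> s - schauder_series \<sigma> t = suminf a"
      unfolding schauder_series_def a_def
      by (intro suminf_diff schauder_series_summable \<sigma>)
    also have "\<dots> = (\<Sum>j. a (j + J)) + (\<Sum>j<J. a j)" by (rule suminf_split_initial_segment[OF sa])
    finally have split: "schauder_series \<sigma> s - schauder_series \<sigma> t = (\<Sum>j. a (j + J)) + (\<Sum>j<J. a j)" .
    have a_fac: "a j = (schauder_layer (\<sigma> j) (2 ^ j * s) - schauder_layer (\<sigma> j) (2 ^ j * t)) / q ^ j" for j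
      by (simp add: a_def q_def power_divide diff_divide_distrib)
    have small: "\<bar>a j\<bar> \<le> 2 * d * q ^ j" for j
    proof -
      have "\<bar>schauder_layer (\<sigma> j) (2 ^ j * s) - schauder_layer (\<sigma> j) (2 ^ j * t)\<bar> \<le> 2 * \<bar>2 ^ j * s - 2 ^ j * t\<bar>"
        by (rule schauder_layer_lipschitz[OF \<sigma>])
      also have "\<dots> = 2 * (2 ^ j * d)" by (simp add: d_def right_diff_distrib[symmetric] abs_mult)
      finally have "\<bar>a j\<bar> \<le> 2 * (2 ^ j * d) / q ^ j" unfolding a_fac abs_divide using q
        by (simp add: divide_right_mono)
      also have "\<dots> = 2 * d * q ^ j" 
      proof -
        have "2 ^ j = q ^ j * q ^ j" unfolding q2[of j, symmetric] mult_2 power_add ..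
        then show ?thesis using q by simp
      qed
      finally show ?thesis .
    qed
    have large: "\<bar>a j\<bar> \<le> 2 * (1 / q) ^ j" for j
    proof -
      have "\<bar>schauder_layer (\<sigma> j) (2 ^ j * s) - schauder_layer (\<sigma> j) (2 ^ j * t)\<bar> \<le> 2"
        using schauder_layer_abs_le[of "\<sigma> j" "2 ^ j * s", OF \<sigma>] schauder_layer_abs_le[of "\<sigma> j" "2 ^ j * t", OF \<sigma>]
        by linarith
      then show ?thesis unfolding a_fac abs_divide using q by (simp add: divide_right_mono power_divide)
    qed
    have "\<bar>\<Sum>j<J. a j\<bar> \<le> (\<Sum>j<J. 2 * d * q ^ j)"
      by (rule order_trans[OF sum_abs sum_mono[OF small]])
    also have "\<dots> = 2 * d * ((q ^ J - 1) / (q - 1))"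
      using q by (simp add: sum_distrib_left[symmetric] geometric_sum)
    also have "\<dots> \<le> 2 * d * (q ^ J / (q - 1))"
      using q d by (intro mult_left_mono divide_right_mono) auto
    also have "\<dots> = 2 / (q - 1) * (q ^ J * d)" by simp
    also have "\<dots> \<le> 2 / (q - 1) * (q * sqrt d)"
      using q high by (intro mult_left_mono) auto
    also have "\<dots> = C / 2 * sqrt d" unfolding C_half by simp
    finally have p1: "\<bar>\<Sum>j<J. a j\<bar> \<le> C / 2 * sqrt d" .
    have sg: "summable (\<lambda>j. 2 * (1 / q) ^ (j + J))"
      using q by (intro summable_mult summable_ignore_initial_segment summable_geometric) simp
    have "\<bar>\<Sum>j. a (j + J)\<bar> \<le> (\<Sum>j. 2 * (1 / q) ^ (j + J))"
      unfolding real_norm_def[symmetric]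
      by (rule norm_suminf_le[OF _ sg]) (use large in simp)
    also have "\<dots> = 2 * (1 / q) ^ J * (\<Sum>j. (1 / q) ^ j)"
      using q by (subst suminf_mult[symmetric]) (auto simp: power_add mult_ac intro!: summable_geometric)
    also have "(\<Sum>j. (1 / q) ^ j) = q / (q - 1)"
      using q by (subst suminf_geometric) (simp_all add: field_simps)
    also have "2 * (1 / q) ^ J * (q / (q - 1)) = 2 * q / (q - 1) * (1 / q ^ J)"
      by (simp add: power_divide)
    also have "\<dots> \<le> 2 * q / (q - 1) * sqrt d"
      using q low by (intro mult_left_mono) auto
    also have "\<dots> = C / 2 * sqrt d" unfolding C_half by simp
    finally have p2: "\<bar>\<Sum>j. a (j + J)\<bar> \<le> C / 2 * sqrt d" .
    have "d powr (1 / 2) = sqrt d" using d by (simp add: powr_half_sqrt)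
    with p1 p2 split show ?thesis unfolding d_def[symmetric] by (simp add: abs_le_iff) linarith
  qed
  show thesis
  proof (rule that[OF C0])
    fix s t :: real assume "s \<in> {0..1}" "t \<in> {0..1}"
    then show "\<bar>schauder_series \<sigma> s - schauder_series \<sigma> t\<bar> \<le> C * \<bar>s - t\<bar> powr (1 / 2)"
      by (cases "s = t") (auto intro: bound)
  qed
qed

text \<open>
  Second differences over dyadic cells diagonalise the Faber-Schauder system: on a cell of level
  \<open>k\<close> the coarser layers are affine, and the finer ones vanish at the end points and
  at the midpoint.
\<close>
lemma schauder_series_second_difference:
  assumes \<sigma>: "\<And>j m. \<bar>\<sigma> j m\<bar> \<le> 1"
  shows "2 * schauder_series \<sigma> (dyadic (Suc k) (2 * n + 1)) - schauder_series \<sigma> (dyadic k n)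
      - schauder_series \<sigma> (dyadic k (Suc n)) = 2 * ((1 / sqrt 2) ^ k * \<sigma> k (int n))"
proof -
  define layer where "layer j t = (1 / sqrt 2) ^ j * schauder_layer (\<sigma> j) (2 ^ j * t)" for j t
  define a where "a j = 2 * layer j (dyadic (Suc k) (2 * n + 1)) - layer j (dyadic k n)
      - layer j (dyadic k (Suc n))" for j
  have sm: "summable (\<lambda>j. layer j t)" for t
    unfolding layer_def by (rule schauder_series_summable) (rule \<sigma>)
  have ss: "schauder_series \<sigma> t = (\<Sum>j. layer j t)" for t
    by (simp add: schauder_series_def layer_def)
  have "2 * schauder_series \<sigma> (dyadic (Suc k) (2 * n + 1)) - schauder_series \<sigma> (dyadic k n)
      - schauder_series \<sigma> (dyadic k (Suc n)) = suminf a"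
    unfolding ss a_def suminf_mult[OF sm, symmetric] suminf_diff[OF summable_mult[OF sm] sm]
    by (rule suminf_diff[OF summable_diff[OF summable_mult[OF sm] sm] sm])
  also have "\<dots> = sum a {k}"
  proof (rule suminf_finite)
    fix j assume "j \<notin> {k}"
    then consider "k < j" | "j < k" by fastforce
    then show "a j = 0"
    proof cases
      case 1
      then obtain i where j: "j = Suc k + i" using less_iff_Suc_add[of k j] by auto
      have "2 ^ j * dyadic (Suc k) (2 * n + 1) = real (2 ^ i * (2 * n + 1))"
        "2 ^ j * dyadic k n = real (2 ^ Suc i * n)" "2 ^ j * dyadic k (Suc n) = real (2 ^ Suc i * Suc n)"
        by (simp_all add: dyadic_def j power_add field_simps)
      then show ?thesis unfolding a_def layer_def by (simp only: schauder_layer_nat)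
    next
      case 2
      then obtain i where k: "k = Suc (j + i)" using less_iff_Suc_add[of j k] by auto
      define p where "p = n div 2 ^ i"
      define x y where "x = real n / 2 ^ Suc i" and "y = real (Suc n) / 2 ^ Suc i"
      have "p * 2 ^ i \<le> n" "n < Suc p * 2 ^ i"
        unfolding p_def using dividend_less_div_times[of "2 ^ i" n] by auto
      then have "real (p * 2 ^ i) \<le> real n" "real (Suc n) \<le> real (Suc p * 2 ^ i)"
        unfolding of_nat_le_iff by simp_all
      then have pxy: "real p / 2 \<le> x" "y \<le> (real p + 1) / 2"
        by (simp_all add: x_def y_def field_simps)
      have xy: "x \<le> y" by (simp add: x_def y_def divide_right_mono)
      define m where "m = int (p div 2)"
      have mid: "2 * schauder_layer s ((x + y) / 2) = schauder_layer s x + schauder_layer s y" for s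
      proof (cases "even p")
        case True
        then have "real p = 2 * real_of_int m" by (auto simp: m_def elim!: evenE)
        with pxy xy have "real_of_int m \<le> x" "x \<le> y" "y \<le> real_of_int m + 1 / 2" by simp_all
        then show ?thesis by (simp add: schauder_layer_left[of m] algebra_simps)
      next
        case False
        then have "real p = 2 * real_of_int m + 1" by (auto simp: m_def elim!: oddE)
        with pxy xy have "real_of_int m + 1 / 2 \<le> x" "x \<le> y" "y \<le> real_of_int m + 1" by simp_all
        then show ?thesis by (simp add: schauder_layer_right[of m] algebra_simps)
      qed
      have pts: "2 ^ j * dyadic (Suc k) (2 * n + 1) = (x + y) / 2"
        "2 ^ j * dyadic k n = x" "2 ^ j * dyadic k (Suc n) = y"
        by (simp_all add: dyadic_def k x_def y_def power_add field_simps)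
      have "a j = (1 / sqrt 2) ^ j * (2 * schauder_layer (\<sigma> j) ((x + y) / 2)
          - schauder_layer (\<sigma> j) x - schauder_layer (\<sigma> j) y)"
        unfolding a_def layer_def pts by (simp add: algebra_simps)
      then show ?thesis unfolding mid by simp
    qed
  qed simp
  also have "\<dots> = 2 * ((1 / sqrt 2) ^ k * \<sigma> k (int n))"
  proof -
    have pts: "2 ^ k * dyadic (Suc k) (2 * n + 1) = real_of_int (int n) + 1 / 2"
        "2 ^ k * dyadic k n = real n" "2 ^ k * dyadic k (Suc n) = real (Suc n)"
      by (simp_all add: dyadic_def field_simps)
    have "schauder_layer (\<sigma> k) (real_of_int (int n) + 1 / 2) = \<sigma> k (int n)"
      by (subst schauder_layer_left[of "int n"]) simp_all
    then show ?thesis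
      unfolding sum.insert[OF finite.emptyI] by (simp only: a_def layer_def pts schauder_layer_nat sum.insert finite.emptyI empty_iff not_False_eq_True sum.empty)
  qed
  finally show ?thesis .
qed

lemma dyadic_sum_unit_step:
  assumes contg: "continuous_on {0..1} g" and f01: "f 0 = 0" "f 1 = 0"
  shows "dyadic_sum (\<lambda>t x. f t) g 0 1 (Suc (Suc j)) - dyadic_sum (\<lambda>t x. f t) g 0 1 (Suc j)
    = (\<Sum>n<2 ^ Suc j. (2 * f (dyadic (Suc (Suc j)) (2 * n + 1)) - f (dyadic (Suc j) n)
         - f (dyadic (Suc j) (Suc n))) * (mean_inc g (Suc (Suc j)) (2 * n + 1) / 2))"
proof -
  define k where "k = Suc j"
  have prim: "primitive (\<lambda>t x. f t) t v = f t * v" for t v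
    by (simp add: primitive_def)
  have cells: "first_cell 0 i = 0" "end_cell 1 i = 2 ^ i" for i
  proof -
    have "\<lfloor>(2::real) ^ i\<rfloor> = 2 ^ i" using floor_of_int[of "2 ^ i", where 'a = real] by simp
    then show "first_cell 0 i = 0" "end_cell 1 i = 2 ^ i"
      by (simp_all add: first_cell_def end_cell_def nat_power_eq)
  qed
  have S: "dyadic_sum (\<lambda>t x. f t) g 0 1 (Suc i) = (\<Sum>n=Suc 0..<2 ^ Suc i. dyadic_term (\<lambda>t x. f t) g (Suc i) n)" for i
    by (subst dyadic_sum_Suc) (simp_all add: cells)
  have half: "dyadic_mean g k n - dyadic_mean g (Suc k) (2 * n) = mean_inc g (Suc k) (2 * n + 1) / 2"
    "dyadic_mean g (Suc k) (2 * n + 1) - dyadic_mean g k n = mean_inc g (Suc k) (2 * n + 1) / 2"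
    if "n < 2 ^ k" for n
    unfolding dyadic_mean_halves[OF contg that] by (simp_all add: mean_inc_def field_simps)
  have ends: "dyadic k 0 = 0" "dyadic k (2 ^ k) = 1" by (simp_all add: dyadic_def)
  have "(\<Sum>m=Suc (2 * 0)..<2 * 2 ^ k. dyadic_term (\<lambda>t x. f t) g (Suc k) m) - (\<Sum>n=Suc 0..<2 ^ k. dyadic_term (\<lambda>t x. f t) g k n)
    = (\<Sum>n=0..<2 ^ k. (f (dyadic (Suc k) (2 * n + 1)) - f (dyadic k n)) * (dyadic_mean g k n - dyadic_mean g (Suc k) (2 * n))
        + (f (dyadic (Suc k) (2 * n + 1)) - f (dyadic k (Suc n))) * (dyadic_mean g (Suc k) (2 * n + 1) - dyadic_mean g k n))"
  proof -
    have alg: "(x * h - x * e) - (y * h - y * e) = (x - y) * (h - e)" for x y h e :: real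
      by (simp add: algebra_simps)
    show ?thesis
      using dyadic_term_refinement[of "\<lambda>t x. f t" 0 "2 ^ k" k g] unfolding prim alg ends f01 by simp
  qed
  also have "\<dots> = (\<Sum>n=0..<2 ^ k. (2 * f (dyadic (Suc k) (2 * n + 1)) - f (dyadic k n)
         - f (dyadic k (Suc n))) * (mean_inc g (Suc k) (2 * n + 1) / 2))"
  proof (rule sum.cong[OF refl])
    fix n :: nat assume "n \<in> {0..<2 ^ k}"
    then have n: "n < 2 ^ k" by simp
    have alg: "(x - y) * w + (x - z) * w = (2 * x - y - z) * w" for x y z w :: real
      by (simp add: algebra_simps)
    show "(f (dyadic (Suc k) (2 * n + 1)) - f (dyadic k n)) * (dyadic_mean g k n - dyadic_mean g (Suc k) (2 * n))
        + (f (dyadic (Suc k) (2 * n + 1)) - f (dyadic k (Suc n))) * (dyadic_mean g (Suc k) (2 * n + 1) - dyadic_mean g k n)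
      = (2 * f (dyadic (Suc k) (2 * n + 1)) - f (dyadic k n)
         - f (dyadic k (Suc n))) * (mean_inc g (Suc k) (2 * n + 1) / 2)"
      unfolding half[OF n] by (rule alg)
  qed
  finally show ?thesis by (simp add: S k_def atLeast0LessThan)
qed

text \<open>
  The coefficient of the Schauder function over a cell is the sign of the difference of the
  two means of \<open>g\<close> over its halves, so that all contributions to the step between two levels add up.
\<close>
lemma not_dg_integrable_if_oscillation:
  assumes contg: "continuous_on {0..1} g" and \<beta>: "0 < \<beta>" "\<beta> \<le> 1 / 2"
    and osc: "\<not> (\<lambda>k. (1 / sqrt 2) ^ k * (\<Sum>n<2 ^ k. \<bar>mean_inc g (Suc k) (2 * n + 1)\<bar>)) \<longlonglongrightarrow> 0"
  shows "\<exists>f\<in>holder \<beta>. \<not> dg_integrable (\<lambda>t x. f t) g 0 1"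
proof -
  define \<sigma> where "\<sigma> k i = sgn (mean_inc g (Suc k) (2 * nat i + 1))" for k :: nat and i :: int
  define f where "f = schauder_series \<sigma>"
  have \<sigma>: "\<bar>\<sigma> j m\<bar> \<le> 1" for j m by (simp add: \<sigma>_def abs_sgn_eq)
  obtain C where "0 \<le> C" "\<And>s t. s \<in> {0..1} \<Longrightarrow> t \<in> {0..1} \<Longrightarrow> \<bar>f s - f t\<bar> \<le> C * \<bar>s - t\<bar> powr (1 / 2)"
    using schauder_series_holder_half[of \<sigma>, OF \<sigma>] unfolding f_def by blast
  with \<beta> have "f \<in> holder \<beta>" by (intro holder_antimono[of f C "1 / 2"])
  moreover have "\<not> dg_integrable (\<lambda>t x. f t) g 0 1"
  proof
    assume "dg_integrable (\<lambda>t x. f t) g 0 1"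
    then obtain I where I: "dyadic_sum (\<lambda>t x. f t) g 0 1 \<longlonglongrightarrow> I"
      by (auto simp: dg_integrable_def has_dg_integral_def)
    have f01: "f 0 = 0" "f 1 = 0"
      using schauder_series_nat[of \<sigma> 0] schauder_series_nat[of \<sigma> 1] by (simp_all add: f_def)
    have "dyadic_sum (\<lambda>t x. f t) g 0 1 (Suc (Suc j)) - dyadic_sum (\<lambda>t x. f t) g 0 1 (Suc j)
        = (1 / sqrt 2) ^ Suc j * (\<Sum>n<2 ^ Suc j. \<bar>mean_inc g (Suc (Suc j)) (2 * n + 1)\<bar>)" for j
      unfolding dyadic_sum_unit_step[of g f, OF contg f01] sum_distrib_left
        schauder_series_second_difference[of \<sigma>, OF \<sigma>, folded f_def]
      by (intro sum.cong refl) (simp add: \<sigma>_def abs_sgn mult_ac)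
    moreover have "(\<lambda>j. dyadic_sum (\<lambda>t x. f t) g 0 1 (Suc (Suc j)) - dyadic_sum (\<lambda>t x. f t) g 0 1 (Suc j))
        \<longlonglongrightarrow> I - I"
      by (intro tendsto_diff LIMSEQ_Suc I)
    ultimately have "(\<lambda>j. (1 / sqrt 2) ^ Suc j * (\<Sum>n<2 ^ Suc j. \<bar>mean_inc g (Suc (Suc j)) (2 * n + 1)\<bar>)) \<longlonglongrightarrow> 0"
      by simp
    then have "(\<lambda>k. (1 / sqrt 2) ^ k * (\<Sum>n<2 ^ k. \<bar>mean_inc g (Suc k) (2 * n + 1)\<bar>)) \<longlonglongrightarrow> 0"
      by (rule LIMSEQ_imp_Suc)
    with osc show False by contradiction
  qed
  ultimately show ?thesis by blast
qed

section \<open>Laplace transforms of Gaussian sums\<close>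

text \<open>
  Fatou's lemma in the form in which bounds for grid averages pass to dyadic means.
\<close>
lemma nn_integral_limit_le:
  fixes X :: "nat \<Rightarrow> 'a \<Rightarrow> real"
  assumes meas: "\<And>N. X N \<in> borel_measurable M"
    and lim: "\<And>x. x \<in> space M \<Longrightarrow> (\<lambda>N. X N x) \<longlonglongrightarrow> Y x"
    and bd: "\<And>N. (\<integral>\<^sup>+x. ennreal (X N x) \<partial>M) \<le> B"
  shows "(\<integral>\<^sup>+x. ennreal (Y x) \<partial>M) \<le> B"
proof -
  have "(\<integral>\<^sup>+x. ennreal (Y x) \<partial>M) = (\<integral>\<^sup>+x. liminf (\<lambda>N. ennreal (X N x)) \<partial>M)"
    using lim by (intro nn_integral_cong lim_imp_Liminf[symmetric] tendsto_ennrealI) auto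
  also have "\<dots> \<le> liminf (\<lambda>N. \<integral>\<^sup>+x. ennreal (X N x) \<partial>M)"
    using meas by (intro nn_integral_liminf) auto
  also have "\<dots> \<le> B"
    using Liminf_mono[of "\<lambda>N. \<integral>\<^sup>+x. ennreal (X N x) \<partial>M" "\<lambda>_. B" sequentially] bd by (simp add: Liminf_const)
  finally show ?thesis .
qed

text \<open>
  The expectation of the cosine of a Gaussian variable is the value of a characteristic function, so
  this estimate bounds a Laplace transform of the absolute value away from 1 without any integration.
\<close>
lemma exp_neg_abs_le_cos: "exp (- \<bar>x\<bar>) \<le> 3 / 4 + cos x / (4::real)"
proof (cases "\<bar>x\<bar> \<le> 1")
  case True
  define y where "y = \<bar>x\<bar>"
  have y: "0 \<le> y" "y \<le> 1" using True by (simp_all add: y_def)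
  have yy: "y\<^sup>2 \<le> y" using y mult_left_mono[of y 1 y] by (simp add: power2_eq_square)
  have "exp (- y) \<le> 1 / (1 + y)"
    using exp_ge_add_one_self[of y] y by (simp add: exp_minus divide_simps)
  also have "\<dots> \<le> 1 - y / 2"
    using y yy by (simp add: divide_simps power2_eq_square algebra_simps)
  finally have "exp (- y) \<le> 1 - y / 2" .
  moreover have "1 - y\<^sup>2 / 2 \<le> cos x"
  proof -
    have "(sin (x / 2))\<^sup>2 \<le> (x / 2)\<^sup>2"
      using abs_sin_x_le_abs_x[of "x / 2"] by (rule abs_le_square_iff[THEN iffD1])
    moreover have "cos x = 1 - 2 * (sin (x / 2))\<^sup>2" using cos_double_sin[of "x / 2"] by simp
    moreover have "y\<^sup>2 = x\<^sup>2" by (simp add: y_def)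
    ultimately show ?thesis by (simp add: power_divide)
  qed
  ultimately show ?thesis using yy y unfolding y_def[symmetric] by linarith
next
  case False
  have "exp (- \<bar>x\<bar>) \<le> exp (- 1)" using False by simp
  also have "\<dots> \<le> 1 / 2"
    using exp_ge_add_one_self[of 1] by (simp add: exp_minus divide_simps)
  finally show ?thesis using cos_ge_minus_one[of x] by linarith
qed

context prob_space
begin

lemma char_scaled_normal:
  assumes X: "distributed M lborel X (normal_density 0 \<sigma>)" and \<sigma>: "0 < \<sigma>"
  shows "char (distr M borel (\<lambda>\<omega>. c * X \<omega>)) 1 = complex_of_real (exp (- (c * \<sigma>)\<^sup>2 / 2))"
proof -
  have std: "distributed M lborel (\<lambda>\<omega>. (X \<omega> - 0) / \<sigma>) std_normal_density"
    using normal_standard_normal_convert[OF \<sigma>, of X 0] X by simp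
  have [measurable]: "X \<in> borel_measurable M" using distributed_measurable[OF X] by simp
  have "distr M borel (\<lambda>\<omega>. X \<omega> / \<sigma>) = std_normal_distribution"
    using distributed_distr_eq_density[OF std] distr_cong[OF refl sets_lborel, of M "\<lambda>\<omega>. X \<omega> / \<sigma>"]
    by simp
  then have "complex_of_real (exp (- (c * \<sigma>)\<^sup>2 / 2)) = char (distr M borel (\<lambda>\<omega>. X \<omega> / \<sigma>)) (c * \<sigma>)"
    by (simp add: char_std_normal_distribution)
  also have "\<dots> = char (distr M borel (\<lambda>\<omega>. c * X \<omega>)) 1"
    using \<sigma> by (simp add: char_def integral_distr)
  finally show ?thesis by simp
qed

lemma expectation_exp_neg_abs_normal_sum_le:
  assumes indep: "indep_vars (\<lambda>_. borel) X I"
    and normal: "\<And>i. i \<in> I \<Longrightarrow> distributed M lborel (X i) (normal_density 0 \<sigma>)" and \<sigma>: "0 < \<sigma>"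
    and I: "finite I"
  shows "expectation (\<lambda>\<omega>. exp (- \<bar>\<Sum>i\<in>I. c i * X i \<omega>\<bar>))
    \<le> 3 / 4 + exp (- (\<sigma>\<^sup>2 * (\<Sum>i\<in>I. (c i)\<^sup>2)) / 2) / 4"
proof -
  define S where "S \<omega> = (\<Sum>i\<in>I. c i * X i \<omega>)" for \<omega>
  have "X i \<in> borel_measurable M" if "i \<in> I" for i
    using distributed_measurable[OF normal[OF that]] by simp
  then have [measurable]: "S \<in> borel_measurable M" unfolding S_def by auto
  have "complex_of_real (expectation (\<lambda>\<omega>. cos (S \<omega>))) = complex_of_real (Re (char (distr M borel S) 1))"
  proof -
    have int: "integrable M (\<lambda>\<omega>. iexp (S \<omega>))"
      by (rule integrable_const_bound[of _ 1]) auto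
    have "char (distr M borel S) 1 = (CLINT \<omega>|M. iexp (S \<omega>))"
      by (simp add: char_def integral_distr)
    then have "Re (char (distr M borel S) 1) = expectation (\<lambda>\<omega>. Re (iexp (S \<omega>)))"
      using int by simp
    then show ?thesis by (simp add: Re_exp)
  qed
  moreover have "char (distr M borel S) 1 = complex_of_real (exp (- (\<sigma>\<^sup>2 * (\<Sum>i\<in>I. (c i)\<^sup>2)) / 2))"
  proof -
    have "indep_vars (\<lambda>_. borel) (\<lambda>i \<omega>. c i * X i \<omega>) I"
      by (rule indep_vars_compose2[OF indep, where Y = "\<lambda>i x. c i * x"]) auto
    then have "char (distr M borel S) 1 = (\<Prod>i\<in>I. char (distr M borel (\<lambda>\<omega>. c i * X i \<omega>)) 1)"
      unfolding S_def by (rule char_distr_sum)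
    also have "\<dots> = (\<Prod>i\<in>I. complex_of_real (exp (- (c i * \<sigma>)\<^sup>2 / 2)))"
      by (intro prod.cong refl char_scaled_normal normal \<sigma>)
    also have "\<dots> = complex_of_real (exp (\<Sum>i\<in>I. - (c i * \<sigma>)\<^sup>2 / 2))"
      by (simp only: exp_sum[OF I] of_real_prod)
    also have "(\<Sum>i\<in>I. - (c i * \<sigma>)\<^sup>2 / 2) = - (\<sigma>\<^sup>2 * (\<Sum>i\<in>I. (c i)\<^sup>2)) / 2"
      by (simp add: sum_distrib_left sum_negf sum_divide_distrib power_mult_distrib mult.commute)
    finally show ?thesis .
  qed
  ultimately have cosE: "expectation (\<lambda>\<omega>. cos (S \<omega>)) = exp (- (\<sigma>\<^sup>2 * (\<Sum>i\<in>I. (c i)\<^sup>2)) / 2)"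
    by (simp only: Re_complex_of_real of_real_eq_iff)
  have icos: "integrable M (\<lambda>\<omega>. cos (S \<omega>))" by (rule integrable_const_bound[of _ 1]) auto
  have "expectation (\<lambda>\<omega>. exp (- \<bar>S \<omega>\<bar>)) \<le> expectation (\<lambda>\<omega>. 3 / 4 + cos (S \<omega>) / 4)"
  proof (rule integral_mono)
    show "integrable M (\<lambda>\<omega>. exp (- \<bar>S \<omega>\<bar>))" by (rule integrable_const_bound[of _ 1]) auto
    show "integrable M (\<lambda>\<omega>. 3 / 4 + cos (S \<omega>) / 4)" using icos by simp
  qed (rule exp_neg_abs_le_cos)
  also have "\<dots> = 3 / 4 + expectation (\<lambda>\<omega>. cos (S \<omega>)) / 4"
    using icos by (simp add: prob_space)
  finally show ?thesis unfolding cosE by (simp add: S_def)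
qed

text \<open>
  For \<open>b\<close> independent blocks the Laplace transform of the sum of the absolute values factorises, so it
  decays geometrically in \<open>b\<close>; hence the sum can hardly be much smaller than \<open>b\<close>.
\<close>
lemma nn_integral_exp_neg_blocks_le:
  assumes indep: "indep_vars (\<lambda>_. borel) X {..<b * L}"
    and normal: "\<And>i. i < b * L \<Longrightarrow> distributed M lborel (X i) (normal_density 0 \<sigma>)" and \<sigma>: "0 < \<sigma>"
  shows "(\<integral>\<^sup>+\<omega>. ennreal (\<Prod>n<b. exp (- \<bar>\<Sum>m<L. w m * X (n * L + m) \<omega>\<bar>)) \<partial>M)
    \<le> ennreal ((3 / 4 + exp (- (\<sigma>\<^sup>2 * (\<Sum>m<L. (w m)\<^sup>2)) / 2) / 4) ^ b)"
proof -
  define K where "K n = (\<lambda>m. n * L + m) ` {..<L}" for n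
  define Z where "Z n \<omega> = exp (- \<bar>\<Sum>i\<in>K n. w (i - n * L) * X i \<omega>\<bar>)" for n \<omega>
  have fin: "finite (K n)" for n by (simp add: K_def)
  have sub: "K n \<subseteq> {..<b * L}" if "n < b" for n
  proof -
    have "n * L + m < b * L" if "m < L" for m
    proof -
      have "n * L + m < Suc n * L" using that by simp
      also have "\<dots> \<le> b * L" using \<open>n < b\<close> by (intro mult_le_mono1) simp
      finally show ?thesis .
    qed
    then show ?thesis by (auto simp: K_def)
  qed
  have disj: "disjoint_family_on K {..<b}"
  proof -
    have "(n * L + m) div L = n" if "m < L" for n m using that by simp
    then have "i \<in> K n \<Longrightarrow> i div L = n" for i n by (auto simp: K_def)
    then show ?thesis unfolding disjoint_family_on_def by blast
  qed
  have reindex: "(\<Sum>i\<in>K n. w (i - n * L) * X i \<omega>) = (\<Sum>m<L. w m * X (n * L + m) \<omega>)" for n \<omega>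
    unfolding K_def by (subst sum.reindex) (auto simp: inj_on_def)
  have reindex2: "(\<Sum>i\<in>K n. (w (i - n * L))\<^sup>2) = (\<Sum>m<L. (w m)\<^sup>2)" for n
    unfolding K_def by (subst sum.reindex) (auto simp: inj_on_def)
  have "indep_vars (\<lambda>n. PiM (K n) (\<lambda>_. borel)) (\<lambda>n \<omega>. restrict (\<lambda>i. X i \<omega>) (K n)) {..<b}"
    by (rule indep_vars_restrict[OF indep _ disj]) (use sub in auto)
  then have "indep_vars (\<lambda>_. borel)
      (\<lambda>n \<omega>. exp (- \<bar>\<Sum>i\<in>K n. w (i - n * L) * restrict (\<lambda>i. X i \<omega>) (K n) i\<bar>)) {..<b}"
    by (rule indep_vars_compose2[where Y = "\<lambda>n x. exp (- \<bar>\<Sum>i\<in>K n. w (i - n * L) * x i\<bar>)"]) measurable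
  then have indepZ: "indep_vars (\<lambda>_. borel) Z {..<b}"
    by (rule indep_vars_cong[THEN iffD1, rotated -1]) (auto simp: Z_def fun_eq_iff intro!: sum.cong arg_cong[where f = abs])
  have measZ: "Z n \<in> borel_measurable M" if "n < b" for n
    using indepZ that by (auto simp: indep_vars_def)
  have intZ: "integrable M (Z n)" if "n < b" for n
    by (rule integrable_const_bound[of _ 1]) (use measZ[OF that] in \<open>auto simp: Z_def\<close>)
  have intP: "integrable M (\<lambda>\<omega>. \<Prod>n<b. Z n \<omega>)"
    by (rule indep_vars_integrable) (use indepZ intZ in auto)
  have EZ: "expectation (Z n) \<le> 3 / 4 + exp (- (\<sigma>\<^sup>2 * (\<Sum>m<L. (w m)\<^sup>2)) / 2) / 4" if "n < b" for n
    unfolding Z_def reindex2[of n, symmetric]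
  proof (rule expectation_exp_neg_abs_normal_sum_le)
    show "indep_vars (\<lambda>_. borel) X (K n)" by (rule indep_vars_subset[OF indep sub[OF that]])
  qed (use sub[OF that] normal \<sigma> fin in auto)
  have "(\<integral>\<^sup>+\<omega>. ennreal (\<Prod>n<b. Z n \<omega>) \<partial>M) = ennreal (expectation (\<lambda>\<omega>. \<Prod>n<b. Z n \<omega>))"
    using intP by (intro nn_integral_eq_integral) (auto simp: Z_def intro!: AE_I2 prod_nonneg)
  also have "expectation (\<lambda>\<omega>. \<Prod>n<b. Z n \<omega>) = (\<Prod>n<b. expectation (Z n))"
    by (rule indep_vars_lebesgue_integral) (use indepZ intZ in auto)
  also have "\<dots> \<le> (\<Prod>n<b. 3 / 4 + exp (- (\<sigma>\<^sup>2 * (\<Sum>m<L. (w m)\<^sup>2)) / 2) / 4)"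
    by (rule prod_mono) (use EZ in \<open>auto simp: Z_def intro!: integral_nonneg_AE AE_I2\<close>)
  finally show ?thesis by (simp add: Z_def reindex ennreal_leI)
qed

end

section \<open>Moments of dyadic means under Wiener measure\<close>

lemma power4_mean_le:
  fixes x :: "nat \<Rightarrow> real"
  assumes "0 < N"
  shows "((\<Sum>j<N. x j) / real N) ^ 4 \<le> (\<Sum>j<N. x j ^ 4) / real N"
proof -
  have sq: "((\<Sum>j<N. y j) / real N)\<^sup>2 \<le> (\<Sum>j<N. (y j)\<^sup>2) / real N" for y :: "nat \<Rightarrow> real"
  proof -
    have "(\<Sum>j<N. y j)\<^sup>2 \<le> real N * (\<Sum>j<N. (y j)\<^sup>2)"
      using Cauchy_Schwarz_ineq_sum[of "\<lambda>_. 1" y "{..<N}"] by simp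
    then show ?thesis using assms by (simp add: power_divide power2_eq_square field_simps)
  qed
  have "((\<Sum>j<N. x j) / real N) ^ 4 = (((\<Sum>j<N. x j) / real N)\<^sup>2)\<^sup>2" by (simp add: power_mult[symmetric])
  also have "\<dots> \<le> ((\<Sum>j<N. (x j)\<^sup>2) / real N)\<^sup>2" by (intro power_mono sq) simp
  also have "\<dots> \<le> (\<Sum>j<N. ((x j)\<^sup>2)\<^sup>2) / real N" by (rule sq)
  finally show ?thesis by (simp add: power_mult[symmetric])
qed

definition grid_mean :: "(real \<Rightarrow> real) \<Rightarrow> nat \<Rightarrow> nat \<Rightarrow> nat \<Rightarrow> real" where
  "grid_mean g k n N = (\<Sum>j<N. g (dyadic k n + real j / (2 ^ k * real N))) / real N"

lemma grid_point_unit: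
  assumes "n < 2 ^ k" "j < N"
  shows "dyadic k n + real j / (2 ^ k * real N) \<in> {0..1}"
proof -
  have "real j / (2 ^ k * real N) \<le> 1 / 2 ^ k" using assms(2) by (simp add: field_simps)
  moreover have "dyadic k (Suc n) \<le> 1" using dyadic_unit[of "Suc n" k] assms(1) by auto
  ultimately have "dyadic k n + real j / (2 ^ k * real N) \<le> 1" by (simp add: dyadic_Suc)
  moreover have "0 \<le> dyadic k n" by (simp add: dyadic_def)
  ultimately show ?thesis by simp
qed

locale wiener_space = prob_space W for W :: "(real \<Rightarrow> real) measure" +
  assumes wiener: "wiener_measure W"
begin

lemma space_W: "space W = C01"
  using wiener by (simp add: wiener_measure_def)

lemma continuous_path: "g \<in> space W \<Longrightarrow> continuous_on {0..1} g"
  by (simp add: space_W C01_def)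

lemma evaluation_measurable:
  assumes "t \<in> {0..1}"
  shows "(\<lambda>g. g t) \<in> borel_measurable W"
proof -
  have "sets W = sets (restrict_space (\<Pi>\<^sub>M t\<in>{0..1}. borel) C01)"
    using wiener by (simp add: wiener_measure_def)
  moreover have "(\<lambda>g. g t) \<in> borel_measurable (restrict_space (\<Pi>\<^sub>M t\<in>{0..1}. borel) C01)"
    by (rule measurable_restrict_space1) (rule measurable_component_singleton[OF assms])
  ultimately show ?thesis using measurable_cong_sets by blast
qed

lemma increment_distributed:
  assumes "0 \<le> s" "s < t" "t \<le> 1"
  shows "distributed W lborel (\<lambda>g. g t - g s) (normal_density 0 (sqrt (t - s)))"
  using wiener assms by (simp add: wiener_measure_def)

lemma increments_indep:
  fixes u :: "nat \<Rightarrow> real"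
  assumes "0 \<le> u 0" "\<And>i. i < m \<Longrightarrow> u i < u (Suc i)" "u m \<le> 1"
  shows "indep_vars (\<lambda>_. borel) (\<lambda>i g. g (u (Suc i)) - g (u i)) {..<m}"
  using wiener assms by (simp add: wiener_measure_def)

lemma increment_fourth_moment:
  assumes "0 \<le> s" "s < t" "t \<le> 1"
  shows "(\<integral>\<^sup>+g. ennreal ((g t - g s) ^ 4) \<partial>W) = ennreal (3 * (t - s)\<^sup>2)"
proof -
  have hb: "has_bochner_integral lborel (\<lambda>x. normal_density 0 (sqrt (t - s)) x * x ^ 4) (3 * (t - s)\<^sup>2)"
  proof -
    have "fact (2 * 2) / ((2 / (sqrt (t - s))\<^sup>2)\<^sup>2 * fact 2) = 3 * (t - s)\<^sup>2"
      using assms by (simp add: fact_numeral power_divide)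
    moreover have "has_bochner_integral lborel (\<lambda>x. normal_density 0 (sqrt (t - s)) x * (x - 0) ^ (2 * 2))
        (fact (2 * 2) / ((2 / (sqrt (t - s))\<^sup>2)\<^sup>2 * fact 2))"
      by (rule normal_moment_even) (use assms in simp)
    ultimately show ?thesis by simp
  qed
  have "(\<integral>\<^sup>+g. ennreal ((g t - g s) ^ 4) \<partial>W)
      = (\<integral>\<^sup>+x. ennreal (normal_density 0 (sqrt (t - s)) x) * ennreal (x ^ 4) \<partial>lborel)"
    by (rule distributed_nn_integral[OF increment_distributed[OF assms], symmetric]) simp
  also have "\<dots> = (\<integral>\<^sup>+x. ennreal (normal_density 0 (sqrt (t - s)) x * x ^ 4) \<partial>lborel)"
    by (simp add: ennreal_mult)
  also have "\<dots> = ennreal (3 * (t - s)\<^sup>2)"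
    using hb by (subst nn_integral_eq_integral) (auto simp: has_bochner_integral_iff)
  finally show ?thesis .
qed

lemma grid_mean_measurable [measurable]:
  assumes "n < 2 ^ k"
  shows "(\<lambda>g. grid_mean g k n N) \<in> borel_measurable W"
  unfolding grid_mean_def
  by (intro borel_measurable_divide borel_measurable_sum borel_measurable_const evaluation_measurable
      grid_point_unit assms) simp

lemma grid_mean_limit:
  assumes "g \<in> space W" "n < 2 ^ k"
  shows "(\<lambda>N. grid_mean g k n (Suc N)) \<longlonglongrightarrow> dyadic_mean g k n"
  unfolding grid_mean_def
  by (rule LIMSEQ_Suc[OF dyadic_mean_grid_limit[OF continuous_path[OF assms(1)] assms(2)]])

lemma dyadic_mean_measurable:
  assumes "n < 2 ^ k"
  shows "(\<lambda>g. dyadic_mean g k n) \<in> borel_measurable W"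
  by (rule borel_measurable_LIMSEQ_real[OF grid_mean_limit[OF _ assms] grid_mean_measurable[OF assms]])

lemma mean_inc_measurable:
  assumes "m < 2 ^ k"
  shows "(\<lambda>g. mean_inc g k m) \<in> borel_measurable W"
  unfolding mean_inc_def
  by (intro borel_measurable_diff dyadic_mean_measurable) (use assms in auto)

text \<open>
  A difference of neighbouring means is an average of increments over the same time span
  \<open>1 / 2 ^ k\<close>; by convexity its fourth moment is at most that of a single increment.
  Second moments would not suffice: the sum of the squares over a level is of order 1 and gives no
  decay of the single differences.
\<close>
lemma mean_inc_fourth_moment:
  assumes m: "1 \<le> m" "m < 2 ^ k"
  shows "(\<integral>\<^sup>+g. ennreal (mean_inc g k m ^ 4) \<partial>W) \<le> ennreal (3 / 4 ^ k)"
proof (rule nn_integral_limit_le)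
  have m': "m - 1 < 2 ^ k" using m by simp
  let ?X = "\<lambda>N g. (grid_mean g k m (Suc N) - grid_mean g k (m - 1) (Suc N)) ^ 4"
  show "?X N \<in> borel_measurable W" for N
    by (intro borel_measurable_power borel_measurable_diff grid_mean_measurable m m')
  show "(\<lambda>N. ?X N g) \<longlonglongrightarrow> mean_inc g k m ^ 4" if "g \<in> space W" for g
    unfolding mean_inc_def by (intro tendsto_intros grid_mean_limit that m m')
  show "(\<integral>\<^sup>+g. ennreal (?X N g) \<partial>W) \<le> ennreal (3 / 4 ^ k)" for N
  proof -
    define a where "a j = dyadic k m + real j / (2 ^ k * real (Suc N))" for j
    define b where "b j = dyadic k (m - 1) + real j / (2 ^ k * real (Suc N))" for j
    have ab: "a j \<in> {0..1}" "b j \<in> {0..1}" if "j < Suc N" for j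
      unfolding a_def b_def by (rule grid_point_unit[OF m(2) that] grid_point_unit[OF m' that])+
    have d: "a j - b j = 1 / 2 ^ k" for j
      using dyadic_Suc[of k "m - 1"] m(1) by (simp add: a_def b_def)
    have meas: "(\<lambda>g. g (a j) - g (b j)) \<in> borel_measurable W" if "j < Suc N" for j
      using ab[OF that] by (intro borel_measurable_diff evaluation_measurable)
    have E: "(\<integral>\<^sup>+g. ennreal ((g (a j) - g (b j)) ^ 4) \<partial>W) = ennreal (3 / 4 ^ k)" if "j < Suc N" for j
    proof -
      have "b j < a j" using d[of j] by (metis diff_gt_0_iff_gt zero_less_divide_1_iff zero_less_numeral zero_less_power)
      then have "(\<integral>\<^sup>+g. ennreal ((g (a j) - g (b j)) ^ 4) \<partial>W) = ennreal (3 * (a j - b j)\<^sup>2)"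
        using ab[OF that] by (intro increment_fourth_moment) auto
      also have "3 * (a j - b j)\<^sup>2 = 3 / 4 ^ k"
        unfolding d by (simp add: power_divide power2_eq_square power_mult_distrib[symmetric])
      finally show ?thesis .
    qed
    have "(\<integral>\<^sup>+g. ennreal (?X N g) \<partial>W)
        \<le> (\<integral>\<^sup>+g. (\<Sum>j<Suc N. ennreal ((g (a j) - g (b j)) ^ 4)) * ennreal (1 / real (Suc N)) \<partial>W)"
    proof (rule nn_integral_mono)
      fix g
      have "grid_mean g k m (Suc N) - grid_mean g k (m - 1) (Suc N) = (\<Sum>j<Suc N. g (a j) - g (b j)) / real (Suc N)"
        unfolding grid_mean_def a_def b_def by (simp only: sum_subtractf diff_divide_distrib)
      then have "?X N g \<le> (\<Sum>j<Suc N. (g (a j) - g (b j)) ^ 4) / real (Suc N)"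
        using power4_mean_le[of "Suc N" "\<lambda>j. g (a j) - g (b j)"] by simp
      then have "ennreal (?X N g) \<le> ennreal ((\<Sum>j<Suc N. (g (a j) - g (b j)) ^ 4) * (1 / real (Suc N)))"
        by (intro ennreal_leI) simp
      then show "ennreal (?X N g) \<le> (\<Sum>j<Suc N. ennreal ((g (a j) - g (b j)) ^ 4)) * ennreal (1 / real (Suc N))"
        by (subst (asm) ennreal_mult) (auto simp del: sum.lessThan_Suc intro: sum_nonneg)
    qed
    also have "\<dots> = (\<integral>\<^sup>+g. (\<Sum>j<Suc N. ennreal ((g (a j) - g (b j)) ^ 4)) \<partial>W) * ennreal (1 / real (Suc N))"
      by (intro nn_integral_multc borel_measurable_sum measurable_compose[OF _ measurable_ennreal] borel_measurable_power meas) simp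
    also have "(\<integral>\<^sup>+g. (\<Sum>j<Suc N. ennreal ((g (a j) - g (b j)) ^ 4)) \<partial>W)
        = (\<Sum>j<Suc N. \<integral>\<^sup>+g. ennreal ((g (a j) - g (b j)) ^ 4) \<partial>W)"
      by (intro nn_integral_sum measurable_compose[OF _ measurable_ennreal] borel_measurable_power meas) simp
    also have "\<dots> = (\<Sum>j<Suc N. ennreal (3 / 4 ^ k))"
      by (intro sum.cong refl E) simp
    also have "\<dots> = ennreal (real (Suc N) * (3 / 4 ^ k))"
      by (subst sum_ennreal) (simp_all del: sum.lessThan_Suc)
    also have "\<dots> * ennreal (1 / real (Suc N)) = ennreal (real (Suc N) * (3 / 4 ^ k) * (1 / real (Suc N)))"
      by (rule ennreal_mult[symmetric]) auto
    also have "real (Suc N) * (3 / 4 ^ k) * (1 / real (Suc N)) = 3 / 4 ^ k"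
      by (simp del: of_nat_Suc)
    finally show ?thesis .
  qed
qed

lemma quartic_variation_expectation:
  "(\<integral>\<^sup>+g. ennreal (\<Sum>m=1..<2 ^ k. mean_inc g k m ^ 4) \<partial>W) \<le> ennreal (3 / 2 ^ k)"
proof -
  have "(\<integral>\<^sup>+g. ennreal (\<Sum>m=1..<2 ^ k. mean_inc g k m ^ 4) \<partial>W)
      = (\<integral>\<^sup>+g. (\<Sum>m=1..<2 ^ k. ennreal (mean_inc g k m ^ 4)) \<partial>W)"
    by (intro nn_integral_cong) (simp add: sum_ennreal)
  also have "\<dots> = (\<Sum>m=1..<2 ^ k. \<integral>\<^sup>+g. ennreal (mean_inc g k m ^ 4) \<partial>W)"
    by (intro nn_integral_sum measurable_compose[OF _ measurable_ennreal] borel_measurable_power mean_inc_measurable) simp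
  also have "\<dots> \<le> (\<Sum>m\<in>{1..<2 ^ k :: nat}. ennreal (3 / 4 ^ k))"
    by (intro sum_mono mean_inc_fourth_moment) auto
  also have "\<dots> = ennreal (real (2 ^ k - 1) * (3 / 4 ^ k))"
    by (subst sum_ennreal) simp_all
  also have "\<dots> \<le> ennreal (3 / 2 ^ k)"
  proof (rule ennreal_leI)
    have "real (2 ^ k - 1) * (3 / 4 ^ k) \<le> 2 ^ k * (3 / 4 ^ k)"
      by (intro mult_right_mono) auto
    also have "\<dots> = 3 / 2 ^ k"
      using power_mult_distrib[of "2::real" 2 k] by (simp add: field_simps)
    finally show "real (2 ^ k - 1) * (3 / 4 ^ k) \<le> 3 / 2 ^ k" .
  qed
  finally show ?thesis .
qed

text \<open>
  The quartic variations, weighted with \<open>2 powr ((1 - \<eta>) k)\<close>, have a summable sequence of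
  expectations, so their sum over \<open>k\<close> is almost surely finite and bounds each of its terms.
\<close>
lemma AE_quartic_variation_bound:
  assumes "0 < \<eta>"
  shows "AE g in W. \<exists>K. \<forall>k. (\<Sum>m=1..<2 ^ k. mean_inc g k m ^ 4) \<le> K * 2 powr (- (1 - \<eta>) * real k)"
proof -
  define V where "V g k = 2 powr ((1 - \<eta>) * real k) * (\<Sum>m=1..<2 ^ k. mean_inc g k m ^ 4)" for g k
  have V0: "0 \<le> V g k" for g k by (simp add: V_def sum_nonneg)
  have meas: "(\<lambda>g. V g k) \<in> borel_measurable W" for k
    unfolding V_def by (intro borel_measurable_times borel_measurable_sum borel_measurable_power borel_measurable_const mean_inc_measurable) simp
  have EV: "(\<integral>\<^sup>+g. ennreal (V g k) \<partial>W) \<le> ennreal (3 * (2 powr (- \<eta>)) ^ k)" for k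
  proof -
    have "(\<integral>\<^sup>+g. ennreal (V g k) \<partial>W) = (\<integral>\<^sup>+g. ennreal (2 powr ((1 - \<eta>) * real k)) * ennreal (\<Sum>m=1..<2 ^ k. mean_inc g k m ^ 4) \<partial>W)"
      unfolding V_def by (intro nn_integral_cong ennreal_mult) (auto intro: sum_nonneg)
    also have "\<dots> = ennreal (2 powr ((1 - \<eta>) * real k)) * (\<integral>\<^sup>+g. ennreal (\<Sum>m=1..<2 ^ k. mean_inc g k m ^ 4) \<partial>W)"
      by (intro nn_integral_cmult measurable_compose[OF _ measurable_ennreal] borel_measurable_sum borel_measurable_power mean_inc_measurable) simp
    also have "\<dots> \<le> ennreal (2 powr ((1 - \<eta>) * real k)) * ennreal (3 / 2 ^ k)"
      by (intro mult_left_mono quartic_variation_expectation) simp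
    also have "\<dots> = ennreal (2 powr ((1 - \<eta>) * real k) * (3 / 2 ^ k))"
      by (rule ennreal_mult[symmetric]) auto
    also have "2 powr ((1 - \<eta>) * real k) * (3 / 2 ^ k) = 3 * (2 powr (- \<eta>)) ^ k"
    proof -
      have "2 powr ((1 - \<eta>) * real k) / 2 ^ k = 2 powr (- \<eta> * real k)"
        by (simp add: powr_realpow[symmetric] powr_diff[symmetric] algebra_simps)
      also have "\<dots> = (2 powr (- \<eta>)) ^ k" by (simp add: powr_realpow[symmetric] powr_powr)
      finally have "2 powr ((1 - \<eta>) * real k) / 2 ^ k = (2 powr (- \<eta>)) ^ k" .
      moreover have "x * (3 / y) = 3 * (x / y)" for x y :: real by simp
      ultimately show ?thesis by (simp only:)
    qed
    finally show ?thesis .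
  qed
  have sum: "summable (\<lambda>k. 3 * (2 powr (- \<eta>)) ^ k)"
    using assms by (intro summable_mult summable_geometric) (simp add: powr_minus divide_simps)
  have "(\<integral>\<^sup>+g. (\<Sum>k. ennreal (V g k)) \<partial>W) = (\<Sum>k. \<integral>\<^sup>+g. ennreal (V g k) \<partial>W)"
    by (intro nn_integral_suminf measurable_compose[OF meas measurable_ennreal])
  also have "\<dots> \<le> (\<Sum>k. ennreal (3 * (2 powr (- \<eta>)) ^ k))"
    by (intro suminf_le EV) auto
  also have "\<dots> = ennreal (\<Sum>k. 3 * (2 powr (- \<eta>)) ^ k)"
    by (rule suminf_ennreal2[OF _ sum]) simp
  finally have "(\<integral>\<^sup>+g. (\<Sum>k. ennreal (V g k)) \<partial>W) \<noteq> \<infinity>" by (auto simp: top_unique)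
  moreover have "(\<lambda>g. \<Sum>k. ennreal (V g k)) \<in> borel_measurable W"
    using meas by measurable
  ultimately have "AE g in W. (\<Sum>k. ennreal (V g k)) \<noteq> \<infinity>"
    by (intro nn_integral_PInf_AE)
  then show ?thesis
  proof eventually_elim
    case (elim g)
    define K where "K = enn2real (\<Sum>k. ennreal (V g k))"
    have "(\<Sum>m=1..<2 ^ k. mean_inc g k m ^ 4) \<le> K * 2 powr (- (1 - \<eta>) * real k)" for k
    proof -
      have "ennreal (V g k) \<le> (\<Sum>k. ennreal (V g k))"
        using sum_le_suminf[of "\<lambda>k. ennreal (V g k)" "{k}"] by simp
      also have "\<dots> = ennreal K" using elim by (simp add: K_def less_top)
      finally have "V g k \<le> K" by (simp add: K_def ennreal_le_iff)
      then have "V g k * 2 powr (- (1 - \<eta>) * real k) \<le> K * 2 powr (- (1 - \<eta>) * real k)"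
        by (rule mult_right_mono) simp
      moreover have "V g k * 2 powr (- (1 - \<eta>) * real k) = (\<Sum>m=1..<2 ^ k. mean_inc g k m ^ 4)
          * (2 powr ((1 - \<eta>) * real k) * 2 powr (- (1 - \<eta>) * real k))"
        by (simp add: V_def)
      moreover have "2 powr ((1 - \<eta>) * real k) * 2 powr (- (1 - \<eta>) * real k) = 1"
        by (simp add: powr_add[symmetric] algebra_simps)
      ultimately show ?thesis by (simp only: mult_1_right)
    qed
    then show ?case by blast
  qed
qed

end

section \<open>Oscillation of dyadic means under Wiener measure\<close>

text \<open>The convolution square of the indicator of \<open>{..<N}\<close>.\<close>
definition overlap :: "nat \<Rightarrow> nat \<Rightarrow> real" where
  "overlap N m = (\<Sum>j<N. \<Sum>i<N. if j + i = m then 1 else 0)"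

lemma sum_overlap:
  fixes F :: "nat \<Rightarrow> real"
  shows "(\<Sum>m<2 * N. overlap N m * F m) = (\<Sum>j<N. \<Sum>i<N. F (j + i))"
proof -
  have "(\<Sum>m<2 * N. overlap N m * F m) = (\<Sum>m<2 * N. \<Sum>j<N. \<Sum>i<N. if m = j + i then F m else 0)"
    unfolding overlap_def sum_distrib_right by (intro sum.cong refl) auto
  also have "\<dots> = (\<Sum>j<N. \<Sum>m<2 * N. \<Sum>i<N. if m = j + i then F m else 0)"
    by (rule sum.swap)
  also have "\<dots> = (\<Sum>j<N. \<Sum>i<N. \<Sum>m<2 * N. if m = j + i then F m else 0)"
    by (intro sum.cong refl sum.swap)
  also have "\<dots> = (\<Sum>j<N. \<Sum>i<N. F (j + i))"
    by (intro sum.cong refl) (simp add: sum.delta)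
  finally show ?thesis .
qed

text \<open>
  This keeps the variance of the grid version of a difference of neighbouring means away from 0,
  uniformly in the number of grid points.
\<close>
lemma sum_overlap_square_ge:
  assumes "0 < N"
  shows "real N ^ 3 / 2 \<le> (\<Sum>m<2 * N. (overlap N m)\<^sup>2)"
proof -
  have "(\<Sum>m<2 * N. overlap N m) = real N * real N"
    using sum_overlap[of N "\<lambda>_. 1"] by simp
  moreover have "(\<Sum>m<2 * N. overlap N m)\<^sup>2 \<le> real (2 * N) * (\<Sum>m<2 * N. (overlap N m)\<^sup>2)"
    using Cauchy_Schwarz_ineq_sum[of "\<lambda>_. 1" "overlap N" "{..<2 * N}"] by simp
  ultimately have "real N * (real N ^ 3) \<le> real N * (2 * (\<Sum>m<2 * N. (overlap N m)\<^sup>2))"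
    by (simp add: power2_eq_square power3_eq_cube mult_ac)
  then show ?thesis using assms by simp
qed

text \<open>
  The difference of the grid means over the two halves of a cell is a fixed linear combination of
  the increments over the grid intervals of that cell; for different cells these are different
  increments, which is where independence comes from.
\<close>
lemma grid_mean_difference:
  fixes g :: "real \<Rightarrow> real" and k n N :: nat
  defines "u \<equiv> \<lambda>i. real i / (2 ^ Suc k * real N)"
  assumes "0 < N"
  shows "grid_mean g (Suc k) (2 * n + 1) N - grid_mean g (Suc k) (2 * n) N
    = (\<Sum>m<2 * N. overlap N m / real N * (g (u (Suc (n * (2 * N) + m))) - g (u (n * (2 * N) + m))))"
proof -
  have pt: "dyadic (Suc k) l + real j / (2 ^ Suc k * real N) = u (l * N + j)" for l j
    using assms(2) by (simp add: dyadic_def u_def add_divide_distrib)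
  define F where "F m = g (u (Suc (n * (2 * N) + m))) - g (u (n * (2 * N) + m))" for m
  have tel: "(\<Sum>i<N. F (j + i)) = g (u ((2 * n + 1) * N + j)) - g (u (2 * n * N + j))" for j
  proof -
    have "(\<Sum>i<N. F (j + i)) = (\<Sum>i<N. g (u (n * (2 * N) + j + Suc i)) - g (u (n * (2 * N) + j + i)))"
      by (simp add: F_def add.assoc)
    also have "\<dots> = g (u (n * (2 * N) + j + N)) - g (u (n * (2 * N) + j + 0))"
      by (rule sum_lessThan_telescope)
    finally show ?thesis by (simp add: algebra_simps)
  qed
  have "grid_mean g (Suc k) (2 * n + 1) N - grid_mean g (Suc k) (2 * n) N
      = (\<Sum>j<N. \<Sum>i<N. F (j + i)) / real N"
    unfolding grid_mean_def pt tel by (simp only: sum_subtractf diff_divide_distrib)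
  also have "\<dots> = (\<Sum>m<2 * N. overlap N m / real N * F m)"
    unfolding sum_overlap[symmetric] sum_divide_distrib by simp
  finally show ?thesis by (simp only: F_def)
qed

context wiener_space
begin

text \<open>
  The factor \<open>sqrt 2 ^ k\<close> normalises the differences to a variance of order 1, so that the bound for
  one cell does not depend on \<open>k\<close>.
\<close>
lemma oscillation_laplace_transform_le:
  "(\<integral>\<^sup>+g. ennreal (\<Prod>n<2 ^ k. exp (- \<bar>sqrt 2 ^ k * mean_inc g (Suc k) (2 * n + 1)\<bar>)) \<partial>W)
    \<le> ennreal ((3 / 4 + exp (- 1 / 8) / 4) ^ 2 ^ k)"
proof (rule nn_integral_limit_le)
  let ?X = "\<lambda>N g. \<Prod>n<2 ^ k. exp (- \<bar>sqrt 2 ^ k *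
      (grid_mean g (Suc k) (2 * n + 1) (Suc N) - grid_mean g (Suc k) (2 * n) (Suc N))\<bar>)"
  have idx: "2 * n + 1 < 2 ^ Suc k" "2 * n < 2 ^ Suc k" if "n < 2 ^ k" for n :: nat
    using that by auto
  show "?X N \<in> borel_measurable W" for N
  proof (rule borel_measurable_prod)
    fix n :: nat assume "n \<in> {..<2 ^ k}"
    then have [measurable]: "(\<lambda>g. grid_mean g (Suc k) (2 * n + 1) (Suc N)) \<in> borel_measurable W"
      "(\<lambda>g. grid_mean g (Suc k) (2 * n) (Suc N)) \<in> borel_measurable W"
      using idx by (auto intro!: grid_mean_measurable)
    show "(\<lambda>g. exp (- \<bar>sqrt 2 ^ k * (grid_mean g (Suc k) (2 * n + 1) (Suc N) - grid_mean g (Suc k) (2 * n) (Suc N))\<bar>)) \<in> borel_measurable W"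
      by measurable
  qed
  show "(\<lambda>N. ?X N g) \<longlonglongrightarrow> (\<Prod>n<2 ^ k. exp (- \<bar>sqrt 2 ^ k * mean_inc g (Suc k) (2 * n + 1)\<bar>))"
    if "g \<in> space W" for g
  proof (rule tendsto_prod)
    fix n :: nat assume "n \<in> {..<2 ^ k}"
    then have "2 * n + 1 < 2 ^ Suc k" "2 * n < 2 ^ Suc k" using idx by auto
    then show "(\<lambda>N. exp (- \<bar>sqrt 2 ^ k * (grid_mean g (Suc k) (2 * n + 1) (Suc N) - grid_mean g (Suc k) (2 * n) (Suc N))\<bar>))
      \<longlonglongrightarrow> exp (- \<bar>sqrt 2 ^ k * mean_inc g (Suc k) (2 * n + 1)\<bar>)"
      using that by (auto simp only: mean_inc_def add_diff_cancel_right' intro!: tendsto_intros grid_mean_limit)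
  qed
  show "(\<integral>\<^sup>+g. ennreal (?X N' g) \<partial>W) \<le> ennreal ((3 / 4 + exp (- 1 / 8) / 4) ^ 2 ^ k)" for N'
  proof -
    define N where "N = Suc N'"
    have N: "0 < N" by (simp add: N_def)
    define \<delta> where "\<delta> = 1 / (2 ^ Suc k * real N)"
    define u where "u i = real i / (2 ^ Suc k * real N)" for i
    define X where "X i g = g (u (Suc i)) - g (u i)" for i and g :: "real \<Rightarrow> real"
    define w where "w m = sqrt 2 ^ k * (overlap N m / real N)" for m
    have \<delta>: "0 < \<delta>" using N by (simp add: \<delta>_def)
    have step: "u (Suc i) - u i = \<delta>" for i by (simp add: u_def \<delta>_def add_divide_distrib)
    have u_last: "u (2 ^ k * (2 * N)) = 1" using N by (simp add: u_def)
    have u_mono: "u i \<le> u j" if "i \<le> j" for i j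
      using that by (simp add: u_def divide_right_mono)
    have u0: "0 \<le> u i" for i by (simp add: u_def)
    have indep: "indep_vars (\<lambda>_. borel) X {..<2 ^ k * (2 * N)}"
    proof -
      have lt: "u i < u (Suc i)" for i using step[of i] \<delta> by linarith
      show ?thesis
        unfolding X_def by (rule increments_indep) (use lt u0 u_last in auto)
    qed
    have normal: "distributed W lborel (X i) (normal_density 0 (sqrt \<delta>))" if "i < 2 ^ k * (2 * N)" for i
    proof -
      have "u (Suc i) \<le> 1" using u_mono[of "Suc i" "2 ^ k * (2 * N)"] that u_last by simp
      then have "distributed W lborel (\<lambda>g. g (u (Suc i)) - g (u i)) (normal_density 0 (sqrt (u (Suc i) - u i)))"
        using step[of i] \<delta> u0[of i] by (intro increment_distributed) auto
      then show ?thesis unfolding X_def step .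
    qed
    have X_eq: "?X N' g = (\<Prod>n<2 ^ k. exp (- \<bar>\<Sum>m<2 * N. w m * X (n * (2 * N) + m) g\<bar>))" for g
      unfolding N_def[symmetric] grid_mean_difference[OF N]
      by (simp only: X_def w_def u_def sum_distrib_left mult.assoc)
    have var: "1 / 4 \<le> (sqrt \<delta>)\<^sup>2 * (\<Sum>m<2 * N. (w m)\<^sup>2)"
    proof -
      have "(sqrt 2 ^ k)\<^sup>2 = (2::real) ^ k"
        by (simp add: power_mult[symmetric] mult.commute[of k 2]) (simp add: power_mult)
      then have "(\<Sum>m<2 * N. (w m)\<^sup>2) = 2 ^ k * ((\<Sum>m<2 * N. (overlap N m)\<^sup>2) / (real N)\<^sup>2)"
        by (simp only: w_def power_mult_distrib power_divide sum_distrib_left sum_divide_distrib)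
      also have "\<dots> \<ge> 2 ^ k * ((real N ^ 3 / 2) / (real N)\<^sup>2)"
        using sum_overlap_square_ge[OF N] by (intro mult_left_mono divide_right_mono) auto
      also have "2 ^ k * ((real N ^ 3 / 2) / (real N)\<^sup>2) = 2 ^ k * real N / 2"
        using N by (simp add: power2_eq_square power3_eq_cube)
      finally have "\<delta> * (2 ^ k * real N / 2) \<le> \<delta> * (\<Sum>m<2 * N. (w m)\<^sup>2)"
        using \<delta> by (intro mult_left_mono) auto
      moreover have "\<delta> * (2 ^ k * real N / 2) = 1 / 4" using N by (simp add: \<delta>_def)
      moreover have "(sqrt \<delta>)\<^sup>2 = \<delta>" using \<delta> by simp
      ultimately show ?thesis by (simp only:)
    qed
    have "(\<integral>\<^sup>+g. ennreal (?X N' g) \<partial>W)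
        \<le> ennreal ((3 / 4 + exp (- ((sqrt \<delta>)\<^sup>2 * (\<Sum>m<2 * N. (w m)\<^sup>2)) / 2) / 4) ^ 2 ^ k)"
      unfolding X_eq using \<delta> by (intro nn_integral_exp_neg_blocks_le indep normal) auto
    also have "\<dots> \<le> ennreal ((3 / 4 + exp (- 1 / 8) / 4) ^ 2 ^ k)"
      using var by (intro ennreal_leI power_mono) auto
    finally show ?thesis .
  qed
qed

text \<open>
  If the normalised oscillation \<open>a k\<close> tended to 0, then
  \<open>exp (2 ^ k * (\<delta> - a k))\<close> would stay above 1, whereas its expectation tends to 0 when \<open>\<delta>\<close>
  is small compared with the decay rate of the Laplace transform.
\<close>
lemma AE_oscillation_not_null:
  "AE g in W. \<not> (\<lambda>k. (1 / sqrt 2) ^ k * (\<Sum>n<2 ^ k. \<bar>mean_inc g (Suc k) (2 * n + 1)\<bar>)) \<longlonglongrightarrow> 0"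
proof -
  define \<rho> where "\<rho> = 3 / 4 + exp (- 1 / 8) / (4::real)"
  have \<rho>: "0 < \<rho>" "\<rho> < 1"
  proof -
    have "0 < exp (- 1 / 8 :: real)" "exp (- 1 / 8) < (1::real)" by simp_all
    then show "0 < \<rho>" "\<rho> < 1" unfolding \<rho>_def by linarith+
  qed
  define \<delta> where "\<delta> = - ln \<rho> / 2"
  have \<delta>: "0 < \<delta>" using \<rho> by (simp add: \<delta>_def)
  define \<tau> where "\<tau> = exp \<delta> * \<rho>"
  have \<tau>: "0 < \<tau>" "\<tau> < 1"
  proof -
    have "\<tau> = exp (\<delta> + ln \<rho>)" using \<rho> by (simp add: \<tau>_def exp_add)
    also have "\<delta> + ln \<rho> = ln \<rho> / 2" by (simp add: \<delta>_def)
    finally show "0 < \<tau>" "\<tau> < 1" using \<rho> by simp_all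
  qed
  define Z where "Z k g = exp (2 ^ k * \<delta>) * (\<Prod>n<2 ^ k. exp (- \<bar>sqrt 2 ^ k * mean_inc g (Suc k) (2 * n + 1)\<bar>))"
    for k g
  have measP: "(\<lambda>g. \<Prod>n<2 ^ k. exp (- \<bar>sqrt 2 ^ k * mean_inc g (Suc k) (2 * n + 1)\<bar>)) \<in> borel_measurable W" for k
  proof (rule borel_measurable_prod)
    fix n :: nat assume "n \<in> {..<2 ^ k}"
    then have [measurable]: "(\<lambda>g. mean_inc g (Suc k) (2 * n + 1)) \<in> borel_measurable W"
      by (intro mean_inc_measurable) auto
    show "(\<lambda>g. exp (- \<bar>sqrt 2 ^ k * mean_inc g (Suc k) (2 * n + 1)\<bar>)) \<in> borel_measurable W" by measurable
  qed
  have measZ: "(\<lambda>g. ennreal (Z k g)) \<in> borel_measurable W" for k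
    unfolding Z_def by (intro measurable_compose[OF _ measurable_ennreal] borel_measurable_times borel_measurable_const measP)
  have EZ: "(\<integral>\<^sup>+g. ennreal (Z k g) \<partial>W) \<le> ennreal (\<tau> ^ k)" for k
  proof -
    have "(\<integral>\<^sup>+g. ennreal (Z k g) \<partial>W) = (\<integral>\<^sup>+g. ennreal (exp (2 ^ k * \<delta>)) *
        ennreal (\<Prod>n<2 ^ k. exp (- \<bar>sqrt 2 ^ k * mean_inc g (Suc k) (2 * n + 1)\<bar>)) \<partial>W)"
      unfolding Z_def by (intro nn_integral_cong ennreal_mult) (auto intro: prod_nonneg)
    also have "\<dots> = ennreal (exp (2 ^ k * \<delta>)) *
        (\<integral>\<^sup>+g. ennreal (\<Prod>n<2 ^ k. exp (- \<bar>sqrt 2 ^ k * mean_inc g (Suc k) (2 * n + 1)\<bar>)) \<partial>W)"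
      by (intro nn_integral_cmult measurable_compose[OF _ measurable_ennreal] measP)
    also have "\<dots> \<le> ennreal (exp (2 ^ k * \<delta>)) * ennreal (\<rho> ^ 2 ^ k)"
      unfolding \<rho>_def by (intro mult_left_mono oscillation_laplace_transform_le) simp
    also have "\<dots> = ennreal (exp (2 ^ k * \<delta>) * \<rho> ^ 2 ^ k)"
      using \<rho> by (intro ennreal_mult[symmetric]) auto
    also have "exp (2 ^ k * \<delta>) * \<rho> ^ 2 ^ k = \<tau> ^ 2 ^ k"
      using exp_of_nat_mult[of "2 ^ k" \<delta>] by (simp add: \<tau>_def power_mult_distrib)
    also have "ennreal (\<tau> ^ 2 ^ k) \<le> ennreal (\<tau> ^ k)"
      using \<tau> by (intro ennreal_leI power_decreasing) (auto intro: less_imp_le)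
    finally show ?thesis .
  qed
  have "(\<integral>\<^sup>+g. liminf (\<lambda>k. ennreal (Z k g)) \<partial>W) \<le> liminf (\<lambda>k. \<integral>\<^sup>+g. ennreal (Z k g) \<partial>W)"
    by (intro nn_integral_liminf measZ)
  also have "\<dots> \<le> liminf (\<lambda>k. ennreal (\<tau> ^ k))"
    by (intro Liminf_mono always_eventually allI EZ)
  also have "\<dots> = 0"
  proof (rule lim_imp_Liminf)
    have "(\<lambda>k. \<tau> ^ k) \<longlonglongrightarrow> 0" using \<tau> by (intro LIMSEQ_power_zero) auto
    then show "(\<lambda>k. ennreal (\<tau> ^ k)) \<longlonglongrightarrow> 0" by (metis tendsto_ennrealI ennreal_0)
  qed simp
  finally have "(\<integral>\<^sup>+g. liminf (\<lambda>k. ennreal (Z k g)) \<partial>W) = 0" by simp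
  moreover have "(\<lambda>g. liminf (\<lambda>k. ennreal (Z k g))) \<in> borel_measurable W"
    by (intro borel_measurable_liminf measZ)
  ultimately have "AE g in W. liminf (\<lambda>k. ennreal (Z k g)) = 0"
    by (simp add: nn_integral_0_iff_AE)
  then show ?thesis
  proof eventually_elim
    case (elim g)
    define a where "a k = (1 / sqrt 2) ^ k * (\<Sum>n<2 ^ k. \<bar>mean_inc g (Suc k) (2 * n + 1)\<bar>)" for k
    have Z_eq: "Z k g = exp (2 ^ k * (\<delta> - a k))" for k
    proof -
      have "sqrt 2 = 2 * (1 / sqrt 2)" by (simp add: real_div_sqrt)
      then have "sqrt 2 ^ k = 2 ^ k * (1 / sqrt 2) ^ k" by (metis power_mult_distrib)
      then have sum: "(\<Sum>n<2 ^ k. \<bar>sqrt 2 ^ k * mean_inc g (Suc k) (2 * n + 1)\<bar>) = 2 ^ k * a k"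
        by (simp add: a_def abs_mult sum_distrib_left mult.assoc power_abs)
      have "(\<Prod>n<2 ^ k. exp (- \<bar>sqrt 2 ^ k * mean_inc g (Suc k) (2 * n + 1)\<bar>))
          = exp (\<Sum>n<2 ^ k. - \<bar>sqrt 2 ^ k * mean_inc g (Suc k) (2 * n + 1)\<bar>)"
        by (rule exp_sum[symmetric]) simp
      also have "\<dots> = exp (- (2 ^ k * a k))" by (simp only: sum_negf sum)
      finally show ?thesis
        unfolding Z_def by (simp add: exp_add[symmetric] right_diff_distrib)
    qed
    have "\<not> a \<longlonglongrightarrow> 0"
    proof
      assume "a \<longlonglongrightarrow> 0"
      then have "\<forall>\<^sub>F k in sequentially. a k < \<delta>" using \<delta> by (rule order_tendstoD)
      then have "\<forall>\<^sub>F k in sequentially. 1 \<le> ennreal (Z k g)"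
        by eventually_elim (simp add: Z_eq)
      then have "1 \<le> liminf (\<lambda>k. ennreal (Z k g))" by (rule Liminf_bounded)
      with elim show False by simp
    qed
    then show ?case by (simp add: a_def[abs_def])
  qed
qed

lemma AE_dg_integrable:
  assumes "1 / 2 < \<beta>"
  shows "AE g in W. \<forall>f\<in>holder2 \<beta>. \<forall>a b. 0 \<le> a \<and> a < b \<and> b \<le> 1 \<longrightarrow> dg_integrable f g a b"
proof -
  \<comment> \<open>The bound for the quartic variation may lose half of the gap between \<open>\<beta>\<close> and 1/2.\<close>
  define \<eta> where "\<eta> = min (1 / 4) ((\<beta> - 1 / 2) / 2)"
  have \<eta>: "0 < \<eta>" "\<eta> \<le> 1 / 4" "1 / 2 + 2 * \<eta> \<le> \<beta>"
    using assms by (auto simp: \<eta>_def min_def field_simps)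
  show ?thesis
    using AE_quartic_variation_bound[OF \<eta>(1)] AE_space
  proof eventually_elim
    case (elim g)
    then obtain K where "\<And>k. (\<Sum>m=1..<2 ^ k. mean_inc g k m ^ 4) \<le> K * 2 powr (- (1 - \<eta>) * real k)"
      by blast
    with elim(2) \<eta> show ?case
      by (auto intro!: dg_integrable_if_quartic_variation_bound[of _ \<beta> g _ _ \<eta> K] continuous_path)
  qed
qed

lemma AE_not_dg_integrable:
  assumes "0 < \<beta>" "\<beta> \<le> 1 / 2"
  shows "AE g in W. \<exists>f\<in>holder \<beta>. \<not> dg_integrable (\<lambda>t x. f t) g 0 1"
  using AE_oscillation_not_null AE_space
  by eventually_elim (rule not_dg_integrable_if_oscillation[OF continuous_path assms])

end

theorem corollary2p2:
  fixes \<beta> :: real and W :: "(real \<Rightarrow> real) measure"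
  assumes "wiener_measure W" and "0 < \<beta>" and "\<beta> \<le> 1"
  shows "((AE g in W. \<forall>f\<in>holder2 \<beta>. \<forall>a b. 0 \<le> a \<and> a < b \<and> b \<le> 1 \<longrightarrow>
              dg_integrable f g a b) \<longleftrightarrow> \<beta> > 1 / 2)
       \<and> ((AE g in W. \<forall>f\<in>holder \<beta>. \<forall>a b. 0 \<le> a \<and> a < b \<and> b \<le> 1 \<longrightarrow>
              dg_integrable (\<lambda>t x. f t) g a b) \<longleftrightarrow> \<beta> > 1 / 2)
       \<and> ((AE g in W. \<exists>f\<in>holder2 \<beta>. \<exists>a b. 0 \<le> a \<and> a < b \<and> b \<le> 1 \<and>
              \<not> dg_integrable f g a b) \<longleftrightarrow> \<beta> \<le> 1 / 2)"
proof -
  interpret wiener_space W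
    using assms(1) by (auto simp: wiener_space_def wiener_space_axioms_def wiener_measure_def)
  let ?all2 = "\<lambda>g. \<forall>f\<in>holder2 \<beta>. \<forall>a b. 0 \<le> a \<and> a < b \<and> b \<le> 1 \<longrightarrow> dg_integrable f g a b"
  let ?all1 = "\<lambda>g. \<forall>f\<in>holder \<beta>. \<forall>a b. 0 \<le> a \<and> a < b \<and> b \<le> 1 \<longrightarrow> dg_integrable (\<lambda>t x. f t) g a b"
  let ?bad2 = "\<lambda>g. \<exists>f\<in>holder2 \<beta>. \<exists>a b. 0 \<le> a \<and> a < b \<and> b \<le> 1 \<and> \<not> dg_integrable f g a b"
  have 21: "?all1 g" if "?all2 g" for g
    using that holder_imp_holder2[OF _ assms(2)] by blast
  have good: "AE g in W. ?all2 g" if "1 / 2 < \<beta>"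
    using AE_dg_integrable[OF that] .
  have bad: "AE g in W. \<not> ?all1 g" if "\<beta> \<le> 1 / 2"
    using AE_not_dg_integrable[OF assms(2) that]
  proof eventually_elim
    case (elim g)
    have "0 \<le> (0::real) \<and> 0 < (1::real) \<and> 1 \<le> (1::real)" by simp
    with elim show ?case by blast
  qed
  have excl: False if "AE g in W. P g" "AE g in W. \<not> P g" for P
  proof -
    from that have "AE g in W. False" by eventually_elim blast
    then show False by simp
  qed
  have "(AE g in W. ?all1 g) \<longleftrightarrow> 1 / 2 < \<beta>"
  proof
    assume "AE g in W. ?all1 g"
    then show "1 / 2 < \<beta>" using bad excl[of ?all1] by (meson not_le)
  next
    assume "1 / 2 < \<beta>"
    from good[OF this] show "AE g in W. ?all1 g" by eventually_elim (rule 21)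
  qed
  moreover have "(AE g in W. ?all2 g) \<longleftrightarrow> 1 / 2 < \<beta>"
  proof
    assume "AE g in W. ?all2 g"
    then have "AE g in W. ?all1 g" by eventually_elim (rule 21)
    then show "1 / 2 < \<beta>" using bad excl[of ?all1] by (meson not_le)
  qed (rule good)
  moreover have "(AE g in W. ?bad2 g) \<longleftrightarrow> \<beta> \<le> 1 / 2"
  proof
    assume "AE g in W. ?bad2 g"
    then have "AE g in W. \<not> ?all2 g" by eventually_elim blast
    then show "\<beta> \<le> 1 / 2" using good excl[of ?all2] by (meson not_le)
  next
    assume "\<beta> \<le> 1 / 2"
    from bad[OF this] show "AE g in W. ?bad2 g"
    proof eventually_elim
      case (elim g)
      then have "\<not> ?all2 g" using 21 by blast
      then show ?case by blast
    qed
  qed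
  ultimately show ?thesis by (intro conjI)
qed

end
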